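(* Let $k,\ell$ be integers with $0\le\ell<k$ and let $L=\{\ell\}$. Then for all sufficiently large $n$, \[\vartheta(G(n,k,L))=1+\frac{\binom{k}{k-\ell}\binom{n-k}{k-\ell}}{\sum_{j=0}^{k-\ell}(-1)^{j+1}\binom{\ell+1}{j}\binom{k-\ell-1}{k-\ell-j}\binom{n-k-\ell-1}{k-\ell-j}},\] and this quantity equals $\frac{\binom{k}{k-\ell}}{(k-\ell)(\ell+1)}n+O(1)$ as $n\to\infty$. Similarly, if $L'=[0,k-1]\setminus\{\ell\}$, then as $n\to\infty$, \[\vartheta(G(n,k,L'))=\frac{\binom{n}{k}}{\vartheta(G(n,k,L))}=\frac{(\ell+1)(k-\ell)}{k!\binom{k}{k-\ell}}n^{k-1}+O(n^{k-2}).\]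
   Context: $[a,b]=\{a,\ldots,b\}$; $\binom{[n]}{k}$ is the family of $k$-subsets of $\{1,\ldots,n\}$. For $L\subset[0,k-1]$, the generalized Johnson graph $G(n,k,L)$ has vertex set $\binom{[n]}{k}$, with $A,B$ adjacent iff $|A\cap B|\notin L$. For a graph $G$ on $N$ vertices, the Lovász number is $\vartheta(G)=\max\sum_{i,j}b_{ij}$ over all $N\times N$ positive semidefinite matrices $B=(b_{ij})$ with trace $1$ and $b_{ij}=0$ whenever $ij$ is an edge. Here $k,\ell$ are fixed and $n\to\infty$. *)

theory Defs
  imports "HOL-Analysis.Analysis" "HOL-Library.Landau_Symbols"
begin

definition johnson_vertices :: "nat \<Rightarrow> nat \<Rightarrow> nat set set" where
  "johnson_vertices n k = {A. A \<subseteq> {1..n} \<and> card A = k}"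

definition johnson_adj :: "nat set \<Rightarrow> nat set \<Rightarrow> nat set \<Rightarrow> bool" where
  "johnson_adj L A B \<longleftrightarrow> A \<noteq> B \<and> card (A \<inter> B) \<notin> L"

definition psd_on :: "'a set \<Rightarrow> ('a \<Rightarrow> 'a \<Rightarrow> real) \<Rightarrow> bool" where
  "psd_on V B \<longleftrightarrow> (\<forall>i\<in>V. \<forall>j\<in>V. B i j = B j i) \<and>
     (\<forall>x :: 'a \<Rightarrow> real. 0 \<le> (\<Sum>i\<in>V. \<Sum>j\<in>V. x i * B i j * x j))"

definition lovasz_theta :: "'a set \<Rightarrow> ('a \<Rightarrow> 'a \<Rightarrow> bool) \<Rightarrow> real" where
  "lovasz_theta V E = Sup {(\<Sum>i\<in>V. \<Sum>j\<in>V. B i j) | B.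
      psd_on V B \<and> (\<Sum>i\<in>V. B i i) = 1 \<and> (\<forall>i\<in>V. \<forall>j\<in>V. E i j \<longrightarrow> B i j = 0)}"

definition theta_johnson :: "nat \<Rightarrow> nat \<Rightarrow> nat set \<Rightarrow> real" where
  "theta_johnson n k L = lovasz_theta (johnson_vertices n k) (johnson_adj L)"

end

theory Submission
  imports Defs "HOL-Combinatorics.Permutations"
begin

text \<open>Let \<open>M\<close> be the matrix of pairs of \<open>k\<close>-sets meeting in exactly \<open>l\<close> points. For disjoint pairs
  \<open>(a\<^sub>1, b\<^sub>1), \<dots>, (a\<^sub>j, b\<^sub>j)\<close> the function \<open>A \<mapsto> \<Prod>r. [a\<^sub>r \<in> A] - [b\<^sub>r \<in> A]\<close> is an eigenvector of every
  matrix of the Johnson scheme, with an Eberlein number as eigenvalue, and these functions with \<open>j \<le> k\<close>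
  span all functions on \<open>k\<close>-sets. For large \<open>n\<close> the least eigenvalue \<open>-\<mu>\<close> of \<open>M\<close> occurs at \<open>j = l + 1\<close>.
  Hence \<open>M + \<mu> I\<close> is positive semidefinite, and summing the rank-one matrices of one such product over
  all permutations of \<open>{1..n}\<close> yields a positive semidefinite \<open>P\<close> in the scheme with \<open>M P = -\<mu> P\<close>.
  These two matrices serve as primal and dual certificates for both graphs; the values are
  \<open>1 + d / \<mu>\<close>, where \<open>d\<close> is the row sum of \<open>M\<close>, and \<open>(n choose k) / (1 + d / \<mu>)\<close>.\<close>

subsection \<open>Semidefinite certificates\<close>

lemma psd_onD: "psd_on V B \<Longrightarrow> 0 \<le> (\<Sum>i\<in>V. \<Sum>j\<in>V. x i * B i j * x j)"
  unfolding psd_on_def by blast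

lemma psd_on_commute: "psd_on V B \<Longrightarrow> i \<in> V \<Longrightarrow> j \<in> V \<Longrightarrow> B i j = B j i"
  unfolding psd_on_def by blast

text \<open>The form is expanded at the vector with value \<open>t\<close> at \<open>v\<close> and
  \<open>x\<close> elsewhere; symmetry merges the two mixed sums. The free parameter
  \<open>t\<close> is what later arguments choose.\<close>

lemma psd_on_quadratic_insert:
  assumes "finite V" "v \<notin> V" "psd_on (insert v V) B"
  shows "0 \<le> t * t * B v v + 2 * t * (\<Sum>j\<in>V. B v j * x j) + (\<Sum>i\<in>V. \<Sum>j\<in>V. x i * B i j * x j)"
proof -
  define y where "y = x(v := t)"
  have y: "y v = t" "\<And>i. i \<in> V \<Longrightarrow> y i = x i"
    using assms(2) by (auto simp: y_def)
  have sym: "B i v = B v i" if "i \<in> V" for i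
    by (rule psd_on_commute[OF assms(3)]) (use that in auto)
  have "0 \<le> (\<Sum>i\<in>insert v V. \<Sum>j\<in>insert v V. y i * B i j * y j)"
    by (rule psd_onD[OF assms(3)])
  also have "\<dots> = t * B v v * t + (\<Sum>j\<in>V. t * B v j * x j)
      + (\<Sum>i\<in>V. x i * B v i * t + (\<Sum>j\<in>V. x i * B i j * x j))"
    using assms(1,2) by (simp add: y sym cong: sum.cong)
  also have "\<dots> = t * t * B v v + 2 * t * (\<Sum>j\<in>V. B v j * x j) + (\<Sum>i\<in>V. \<Sum>j\<in>V. x i * B i j * x j)"
  proof -
    have "(\<Sum>j\<in>V. t * B v j * x j) = t * (\<Sum>j\<in>V. B v j * x j)"
      by (simp add: sum_distrib_left mult.assoc)
    moreover have "(\<Sum>i\<in>V. x i * B v i * t) = t * (\<Sum>j\<in>V. B v j * x j)"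
      by (simp add: sum_distrib_left mult_ac)
    ultimately show ?thesis by (simp add: sum.distrib)
  qed
  finally show ?thesis .
qed

lemma psd_on_diag_nonneg:
  assumes "finite V" "v \<in> V" "psd_on V B"
  shows "0 \<le> B v v"
  using psd_on_quadratic_insert[of "V - {v}" v B 1 "\<lambda>_. 0"] assms by (simp add: insert_absorb)

text \<open>With a vanishing pivot the form is affine in \<open>t\<close>, and a nonzero slope would
  drive it below zero.\<close>

lemma psd_on_zero_row:
  assumes "finite V" "v \<notin> V" "psd_on (insert v V) B" "B v v = 0" "w \<in> V"
  shows "B v w = 0"
proof (rule ccontr)
  assume nz: "B v w \<noteq> 0"
  define x where "x = (\<lambda>i. of_bool (i = w) :: real)"
  define q where "q = (\<Sum>i\<in>V. \<Sum>j\<in>V. x i * B i j * x j)"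
  have "(\<Sum>j\<in>V. B v j * x j) = B v w"
    using assms(1,5) by (simp add: x_def of_bool_def if_distrib cong: if_cong)
  then have "0 \<le> 2 * t * B v w + q" for t
    using psd_on_quadratic_insert[OF assms(1-3), of t x] assms(4) by (simp add: q_def)
  \<comment> \<open>This \<open>t\<close> makes the affine expression equal to -1.\<close>
  from this[of "- (q + 1) / (2 * B v w)"] nz show False
    by (simp add: field_simps)
qed

text \<open>Cholesky factorisation: each step splits off one rank-one matrix, and the Schur complement
  of the pivot is positive semidefinite on the remaining indices.\<close>

lemma psd_on_rank_one_decomposition:
  assumes "finite V" "psd_on V B"
  shows "\<exists>(m::nat) g. \<forall>i\<in>V. \<forall>j\<in>V. B i j = (\<Sum>s<m. g s i * g s j)"
  using assms
proof (induction V arbitrary: B rule: finite_induct)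
  case empty
  then show ?case by simp
next
  case (insert v V)
  have sym: "B i j = B j i" if "i \<in> insert v V" "j \<in> insert v V" for i j
    using psd_on_commute[OF insert.prems] that by blast
  \<comment> \<open>The Cholesky column of the pivot \<open>v\<close>. For a zero pivot, division by
    zero gives \<open>h = 0\<close>, which is consistent because the whole row \<open>v\<close> then
    vanishes.\<close>
  define h where "h = (\<lambda>i. B v i / sqrt (B v v))"
  have nonneg: "0 \<le> B v v"
    using psd_on_diag_nonneg[OF _ _ insert.prems] insert.hyps by auto
  have h_row: "h v * h i = B v i" if "i \<in> insert v V" for i
  proof (cases "B v v = 0")
    case True
    then show ?thesis
      using psd_on_zero_row[OF insert.hyps(1,2) insert.prems] that by (auto simp: h_def)
  next
    case False
    then show ?thesis using nonneg by (simp add: h_def real_div_sqrt)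
  qed
  define C where "C = (\<lambda>i j. B i j - h i * h j)"
  have "psd_on V C"
    unfolding psd_on_def
  proof (intro conjI ballI allI)
    fix i j assume "i \<in> V" "j \<in> V"
    then show "C i j = C j i" using sym by (simp add: C_def)
  next
    fix x :: "'a \<Rightarrow> real"
    define b where "b = (\<Sum>j\<in>V. B v j * x j)"
    define q where "q = (\<Sum>i\<in>V. \<Sum>j\<in>V. x i * B i j * x j)"
    have h_sum: "(\<Sum>i\<in>V. h i * x i) = b / sqrt (B v v)"
      by (simp add: h_def b_def sum_divide_distrib)
    have "(\<Sum>i\<in>V. \<Sum>j\<in>V. x i * C i j * x j) = q - (\<Sum>i\<in>V. h i * x i) * (\<Sum>j\<in>V. h j * x j)"
      by (simp add: C_def q_def sum_product algebra_simps sum_subtractf)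
    also have "\<dots> = q - b * b / B v v"
      using nonneg by (simp add: h_sum)
    also have "0 \<le> q - b * b / B v v"
    proof -
      \<comment> \<open>Completing the square: for a positive pivot this \<open>t\<close> minimises
        the form. For a zero pivot it is 0, and both sides collapse to \<open>q\<close>.\<close>
      have "0 \<le> (- b / B v v) * (- b / B v v) * B v v + 2 * (- b / B v v) * b + q"
        using psd_on_quadratic_insert[OF insert.hyps(1,2) insert.prems, of "- b / B v v" x]
        by (simp only: b_def q_def)
      also have "\<dots> = q - b * b / B v v"
        by (cases "B v v = 0") (simp_all add: field_simps)
      finally show ?thesis .
    qed
    finally show "0 \<le> (\<Sum>i\<in>V. \<Sum>j\<in>V. x i * C i j * x j)" .
  qed
  from insert.IH[OF this] obtain m :: nat and g
    where g: "\<And>i j. i \<in> V \<Longrightarrow> j \<in> V \<Longrightarrow> C i j = (\<Sum>s<m. g s i * g s j)"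
    by blast
  \<comment> \<open>Old factors are extended by 0 at \<open>v\<close>, so that row and column
    \<open>v\<close> come from \<open>h\<close> alone.\<close>
  define g' where "g' = (\<lambda>s i. if s < m then (if i = v then 0 else g s i) else h i)"
  have "B i j = (\<Sum>s<Suc m. g' s i * g' s j)" if "i \<in> insert v V" "j \<in> insert v V" for i j
  proof (cases "i = v \<or> j = v")
    case True
    then have "(\<Sum>s<m. g' s i * g' s j) = 0"
      by (intro sum.neutral) (auto simp: g'_def)
    moreover have "h i * h j = B i j"
      using True h_row sym that by (metis mult.commute)
    ultimately show ?thesis by (simp add: g'_def)
  next
    case False
    then have "(\<Sum>s<m. g' s i * g' s j) = C i j"
      using that by (subst g) (auto simp: g'_def)
    then show ?thesis by (simp add: g'_def C_def)
  qed
  then show ?case by blast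
qed

text \<open>Weak duality behind both upper bounds: splitting \<open>B\<close> into rank-one terms
  turns the inner product into a sum of values of the quadratic form of \<open>C\<close>.\<close>

lemma psd_on_inner_nonneg:
  assumes "finite V" "psd_on V B" "psd_on V C"
  shows "0 \<le> (\<Sum>i\<in>V. \<Sum>j\<in>V. B i j * C i j)"
proof -
  from psd_on_rank_one_decomposition[OF assms(1,2)] obtain m :: nat and g
    where g: "\<And>i j. i \<in> V \<Longrightarrow> j \<in> V \<Longrightarrow> B i j = (\<Sum>s<m. g s i * g s j)"
    by blast
  have "(\<Sum>i\<in>V. \<Sum>j\<in>V. B i j * C i j) = (\<Sum>i\<in>V. \<Sum>j\<in>V. \<Sum>s<m. g s i * C i j * g s j)"
    by (intro sum.cong refl) (simp add: g sum_distrib_left sum_distrib_right mult_ac)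
  also have "\<dots> = (\<Sum>s<m. \<Sum>i\<in>V. \<Sum>j\<in>V. g s i * C i j * g s j)"
    by (simp add: sum.swap[of _ "{..<m}"])
  also have "0 \<le> \<dots>"
    by (intro sum_nonneg psd_onD[OF assms(3)])
  finally show ?thesis .
qed

text \<open>A feasible matrix attaining an upper bound is a maximum, so the supremum is read off
  from a primal and a dual certificate.\<close>

lemma lovasz_theta_eqI:
  assumes "psd_on V B" "(\<Sum>i\<in>V. B i i) = 1" "\<And>i j. i \<in> V \<Longrightarrow> j \<in> V \<Longrightarrow> E i j \<Longrightarrow> B i j = 0"
    and "(\<Sum>i\<in>V. \<Sum>j\<in>V. B i j) = t"
    and "\<And>B. psd_on V B \<Longrightarrow> (\<Sum>i\<in>V. B i i) = 1 \<Longrightarrow>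
      (\<And>i j. i \<in> V \<Longrightarrow> j \<in> V \<Longrightarrow> E i j \<Longrightarrow> B i j = 0) \<Longrightarrow> (\<Sum>i\<in>V. \<Sum>j\<in>V. B i j) \<le> t"
  shows "lovasz_theta V E = t"
  unfolding lovasz_theta_def
  by (rule cSup_eq_maximum) (use assms in blast)+

section \<open>Scaling, and shifts by the all-ones matrix\<close>

lemma psd_on_cmult:
  assumes "psd_on V B" "0 \<le> c"
  shows "psd_on V (\<lambda>i j. c * B i j)"
  unfolding psd_on_def
proof (intro conjI ballI allI)
  fix x :: "'a \<Rightarrow> real"
  have "(\<Sum>i\<in>V. \<Sum>j\<in>V. x i * (c * B i j) * x j) = c * (\<Sum>i\<in>V. \<Sum>j\<in>V. x i * B i j * x j)"
    by (simp add: sum_distrib_left algebra_simps)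
  then show "0 \<le> (\<Sum>i\<in>V. \<Sum>j\<in>V. x i * (c * B i j) * x j)"
    using psd_onD[OF assms(1)] assms(2) by simp
qed (use psd_on_commute[OF assms(1)] in auto)

lemma psd_on_add_const:
  assumes "psd_on V B" "0 \<le> c"
  shows "psd_on V (\<lambda>i j. B i j + c)"
  unfolding psd_on_def
proof (intro conjI ballI allI)
  fix x :: "'a \<Rightarrow> real"
  have "(\<Sum>i\<in>V. \<Sum>j\<in>V. x i * (B i j + c) * x j)
      = (\<Sum>i\<in>V. \<Sum>j\<in>V. x i * B i j * x j) + c * ((\<Sum>i\<in>V. x i) * (\<Sum>i\<in>V. x i))"
    by (simp add: sum_product sum_distrib_left algebra_simps sum.distrib)
  then show "0 \<le> (\<Sum>i\<in>V. \<Sum>j\<in>V. x i * (B i j + c) * x j)"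
    using psd_onD[OF assms(1)] assms(2) by simp
qed (use psd_on_commute[OF assms(1)] in auto)

text \<open>Constant row sums make the all-ones vector an eigenvector with eigenvalue
  \<open>r\<close>. Removing its component from \<open>B\<close> keeps the matrix positive
  semidefinite; the result is rescaled by \<open>card V / r\<close>.\<close>

lemma psd_on_sub_const:
  assumes fin: "finite V" and psd: "psd_on V B" and r: "0 < r"
    and row: "\<And>i. i \<in> V \<Longrightarrow> (\<Sum>j\<in>V. B i j) = r"
  shows "psd_on V (\<lambda>i j. real (card V) / r * B i j - 1)"
  unfolding psd_on_def
proof (intro conjI ballI allI)
  fix x :: "'a \<Rightarrow> real"
  define N s where "N = real (card V)" and "s = (\<Sum>i\<in>V. x i)"
  define q where "q = (\<Sum>i\<in>V. \<Sum>j\<in>V. x i * B i j * x j)"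
  have nonneg: "N * q - r * s * s \<ge> 0"
  proof (cases "V = {}")
    case True
    then show ?thesis by (simp add: q_def s_def)
  next
    case False
    then have N: "N > 0" using fin by (simp add: N_def card_gt_0_iff)
    \<comment> \<open>Subtracting the mean projects \<open>x\<close> away from the all-ones
      vector.\<close>
    define c where "c = s / N"
    have 1: "(\<Sum>i\<in>V. \<Sum>j\<in>V. B i j * x i) = r * s"
      by (simp add: row s_def sum_distrib_left flip: sum_distrib_right)
    have "(\<Sum>i\<in>V. \<Sum>j\<in>V. B i j * x j) = (\<Sum>i\<in>V. \<Sum>j\<in>V. B i j * x i)"
      by (subst sum.swap) (intro sum.cong refl arg_cong2[where f = "(*)"] psd_on_commute[OF psd])
    then have 2: "(\<Sum>i\<in>V. \<Sum>j\<in>V. B i j * x j) = r * s"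
      by (simp only: 1)
    have 3: "(\<Sum>i\<in>V. \<Sum>j\<in>V. B i j) = r * N"
      by (simp add: row N_def)
    have "0 \<le> (\<Sum>i\<in>V. \<Sum>j\<in>V. (x i - c) * B i j * (x j - c))"
      by (rule psd_onD[OF psd])
    also have "\<dots> = q - c * (\<Sum>i\<in>V. \<Sum>j\<in>V. B i j * x i) - c * (\<Sum>i\<in>V. \<Sum>j\<in>V. B i j * x j)
        + c * c * (\<Sum>i\<in>V. \<Sum>j\<in>V. B i j)"
      by (simp add: q_def sum_distrib_left algebra_simps sum.distrib sum_subtractf)
    also have "\<dots> = q - r * s * s / N"
      using N by (simp only: 1 2 3) (simp add: c_def field_simps)
    finally show ?thesis using N by (simp add: field_simps)
  qed
  have "(\<Sum>i\<in>V. \<Sum>j\<in>V. x i * (N / r * B i j - 1) * x j) = N / r * q - s * s"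
    unfolding q_def s_def sum_product
    by (simp add: sum_distrib_left algebra_simps sum_subtractf)
  also have "\<dots> = (N * q - r * s * s) / r" using r by (simp add: field_simps)
  also have "0 \<le> \<dots>" using nonneg r by simp
  finally show "0 \<le> (\<Sum>i\<in>V. \<Sum>j\<in>V. x i * (real (card V) / r * B i j - 1) * x j)"
    by (simp only: N_def)
qed (use psd_on_commute[OF psd] in auto)

text \<open>The matrix \<open>M + \<mu> I\<close> is primal optimal for the first graph and, after subtracting a multiple
  of the all-ones matrix, dual optimal for the second; \<open>P\<close> plays the opposite roles.\<close>

lemma lovasz_theta_regular_pair:
  fixes V :: "'a set" and M P :: "'a \<Rightarrow> 'a \<Rightarrow> real" and r :: "'a \<Rightarrow> 'a \<Rightarrow> bool"
  assumes fin: "finite V" and ne: "V \<noteq> {}"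
    and M: "\<And>i j. M i j = of_bool (r i j)"
    and irrefl: "\<And>i. i \<in> V \<Longrightarrow> \<not> r i i"
    and reg: "\<And>i. i \<in> V \<Longrightarrow> (\<Sum>j\<in>V. M i j) = d"
    and pos: "d > 0" "\<mu> > 0" "p0 > 0"
    and psdM: "psd_on V (\<lambda>i j. M i j + \<mu> * of_bool (i = j))"
    and psdP: "psd_on V P"
    and P0: "\<And>i. i \<in> V \<Longrightarrow> P i i = p0"
    and P1: "\<And>i j. i \<in> V \<Longrightarrow> j \<in> V \<Longrightarrow> r i j \<Longrightarrow> P i j = p1"
    and eig: "\<And>i h. i \<in> V \<Longrightarrow> h \<in> V \<Longrightarrow> (\<Sum>j\<in>V. M i j * P j h) = - \<mu> * P i h"
    and E: "\<And>i j. i \<in> V \<Longrightarrow> j \<in> V \<Longrightarrow> E i j \<longleftrightarrow> i \<noteq> j \<and> \<not> r i j"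
    and E': "\<And>i j. i \<in> V \<Longrightarrow> j \<in> V \<Longrightarrow> E' i j \<longleftrightarrow> r i j"
  shows "lovasz_theta V E = 1 + d / \<mu>"
    and "lovasz_theta V E' = real (card V) / (1 + d / \<mu>)"
proof -
  define N where "N = real (card V)"
  have N: "N > 0" using fin ne by (simp add: N_def card_gt_0_iff)
  have symM: "M i j = M j i" if "i \<in> V" "j \<in> V" for i j
    using psd_on_commute[OF psdM that] by (simp add: eq_commute[of i j])
  have symr: "r i j = r j i" if "i \<in> V" "j \<in> V" for i j
    using symM[OF that] by (auto simp: M of_bool_def split: if_splits)
  \<comment> \<open>The eigenvector equation at a diagonal entry: only neighbours of
    \<open>i\<close> contribute, each of them \<open>p1\<close>.\<close>
  have p1: "p1 = - \<mu> * p0 / d"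
  proof -
    obtain i where i: "i \<in> V" using ne by blast
    have "(\<Sum>j\<in>V. M i j * P j i) = (\<Sum>j\<in>V. M i j * p1)"
      using i by (intro sum.cong refl) (auto simp: M P1 symr)
    also have "\<dots> = d * p1"
      using i by (simp add: reg flip: sum_distrib_right)
    finally show ?thesis using eig[OF i i] P0[OF i] pos by (simp add: field_simps)
  qed
  then have p1_neg: "p1 < 0" using pos by (simp add: divide_neg_pos mult_neg_pos)
  \<comment> \<open>The all-ones vector has eigenvalue \<open>d\<close> and the columns of
    \<open>P\<close> have eigenvalue \<open>- \<mu>\<close> under the symmetric \<open>M\<close>, so
    they are orthogonal.\<close>
  have col: "(\<Sum>j\<in>V. P j h) = 0" if h: "h \<in> V" for h
  proof -
    have "- \<mu> * (\<Sum>j\<in>V. P j h) = (\<Sum>i\<in>V. \<Sum>j\<in>V. M i j * P j h)"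
      by (simp add: sum_distrib_left eig h)
    also have "\<dots> = (\<Sum>j\<in>V. (\<Sum>i\<in>V. M j i) * P j h)"
      by (subst sum.swap) (auto simp: sum_distrib_right symM intro!: sum.cong)
    also have "\<dots> = d * (\<Sum>j\<in>V. P j h)"
      by (simp add: reg sum_distrib_left)
    finally have "(d + \<mu>) * (\<Sum>j\<in>V. P j h) = 0" by (simp add: algebra_simps)
    then show ?thesis using pos by simp
  qed
  have diag: "(\<Sum>j\<in>V. c j * of_bool (i = j)) = c i" if "i \<in> V" for i and c :: "'a \<Rightarrow> real"
    using fin that by (simp add: of_bool_def if_distrib cong: if_cong)
  have rowM: "(\<Sum>j\<in>V. M i j + \<mu> * of_bool (i = j)) = d + \<mu>" if "i \<in> V" for i
    using diag[OF that, of "\<lambda>_. \<mu>"] reg[OF that] by (simp add: sum.distrib)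
  show "lovasz_theta V E = 1 + d / \<mu>"
  proof (rule lovasz_theta_eqI)
    show "psd_on V (\<lambda>i j. 1 / (\<mu> * N) * (M i j + \<mu> * of_bool (i = j)))"
      using pos N by (intro psd_on_cmult psdM) simp
    show "(\<Sum>i\<in>V. 1 / (\<mu> * N) * (M i i + \<mu> * of_bool (i = i))) = 1"
      using pos N irrefl by (simp add: M N_def[symmetric])
    have "(\<Sum>i\<in>V. \<Sum>j\<in>V. M i j + \<mu> * of_bool (i = j)) = N * (d + \<mu>)"
      using rowM by (simp add: N_def)
    then have "(\<Sum>i\<in>V. \<Sum>j\<in>V. 1 / (\<mu> * N) * (M i j + \<mu> * of_bool (i = j))) = 1 / (\<mu> * N) * (N * (d + \<mu>))"
      by (simp only: flip: sum_distrib_left)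
    also have "\<dots> = 1 + d / \<mu>"
      using pos N by (simp add: field_simps)
    finally show "(\<Sum>i\<in>V. \<Sum>j\<in>V. 1 / (\<mu> * N) * (M i j + \<mu> * of_bool (i = j))) = 1 + d / \<mu>" .
  next
    fix i j assume "i \<in> V" "j \<in> V" "E i j"
    then show "1 / (\<mu> * N) * (M i j + \<mu> * of_bool (i = j)) = 0"
      by (auto simp: E M)
  next
    fix B assume B: "psd_on V B" "(\<Sum>i\<in>V. B i i) = 1"
      and B0: "\<And>i j. i \<in> V \<Longrightarrow> j \<in> V \<Longrightarrow> E i j \<Longrightarrow> B i j = 0"
    \<comment> \<open>Where \<open>B\<close> may be nonzero, on the diagonal and on
      \<open>r\<close>, \<open>P\<close> is the constant \<open>p1\<close> plus
      \<open>p0 - p1\<close> on the diagonal.\<close>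
    have "B i j * P i j = p1 * B i j + (p0 - p1) * (B i j * of_bool (i = j))"
      if "i \<in> V" "j \<in> V" for i j
      using B0[OF that] that by (cases "i = j"; cases "r i j") (auto simp: P0 P1 E algebra_simps)
    then have "(\<Sum>i\<in>V. \<Sum>j\<in>V. B i j * P i j)
        = (\<Sum>i\<in>V. \<Sum>j\<in>V. p1 * B i j + (p0 - p1) * (B i j * of_bool (i = j)))"
      by (intro sum.cong refl) blast
    also have "\<dots> = p1 * (\<Sum>i\<in>V. \<Sum>j\<in>V. B i j) + (p0 - p1) * (\<Sum>i\<in>V. B i i)"
      by (simp add: sum.distrib diag flip: sum_distrib_left)
    finally have "0 \<le> p1 * (\<Sum>i\<in>V. \<Sum>j\<in>V. B i j) + (p0 - p1)"
      using psd_on_inner_nonneg[OF fin B(1) psdP] B(2) by simp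
    then have "(\<Sum>i\<in>V. \<Sum>j\<in>V. B i j) \<le> (p0 - p1) / (- p1)"
      using p1_neg by (simp add: field_simps)
    also have "\<dots> = 1 + d / \<mu>"
      using pos by (simp add: p1 field_simps)
    finally show "(\<Sum>i\<in>V. \<Sum>j\<in>V. B i j) \<le> 1 + d / \<mu>" .
  qed
  show "lovasz_theta V E' = real (card V) / (1 + d / \<mu>)"
  proof (rule lovasz_theta_eqI)
    \<comment> \<open>The positive shift by \<open>- p1\<close> makes \<open>P\<close> vanish on
      \<open>r\<close>. Since the columns of \<open>P\<close> sum to zero, the total comes from the
      shift alone.\<close>
    show "psd_on V (\<lambda>i j. 1 / (N * (p0 - p1)) * (P i j + (- p1)))"
      using pos N p1_neg by (intro psd_on_cmult psd_on_add_const psdP) simp_all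
    show "(\<Sum>i\<in>V. 1 / (N * (p0 - p1)) * (P i i + (- p1))) = 1"
      using pos N p1_neg by (simp add: P0 N_def[symmetric])
    have "(\<Sum>i\<in>V. \<Sum>j\<in>V. P i j + (- p1)) = N * N * (- p1)"
      by (subst sum.swap) (simp add: sum.distrib sum_subtractf col N_def)
    then have "(\<Sum>i\<in>V. \<Sum>j\<in>V. 1 / (N * (p0 - p1)) * (P i j + (- p1))) = 1 / (N * (p0 - p1)) * (N * N * (- p1))"
      by (simp only: flip: sum_distrib_left)
    also have "\<dots> = real (card V) / (1 + d / \<mu>)"
    proof -
      define s where "s = d + \<mu>"
      have eqs: "p0 - p1 = p0 * s / d" "1 + d / \<mu> = s / \<mu>" "- p1 = \<mu> * p0 / d"
        using pos by (simp_all add: p1 s_def field_simps)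
      have "s > 0" using pos by (simp add: s_def)
      then show ?thesis unfolding N_def[symmetric] eqs using pos N by (simp add: field_simps)
    qed
    finally show "(\<Sum>i\<in>V. \<Sum>j\<in>V. 1 / (N * (p0 - p1)) * (P i j + (- p1))) = real (card V) / (1 + d / \<mu>)" .
  next
    fix i j assume "i \<in> V" "j \<in> V" "E' i j"
    then show "1 / (N * (p0 - p1)) * (P i j + (- p1)) = 0"
      by (simp add: E' P1)
  next
    fix B assume B: "psd_on V B" "(\<Sum>i\<in>V. B i i) = 1"
      and B0: "\<And>i j. i \<in> V \<Longrightarrow> j \<in> V \<Longrightarrow> E' i j \<Longrightarrow> B i j = 0"
    \<comment> \<open>This factor brings all row sums of \<open>M + \<mu> I\<close> to
      \<open>N\<close>, so the all-ones matrix can be subtracted.\<close>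
    define c where "c = N / (d + \<mu>)"
    have "0 \<le> (\<Sum>i\<in>V. \<Sum>j\<in>V. B i j * (c * (M i j + \<mu> * of_bool (i = j)) - 1))"
      unfolding c_def N_def using pos
      by (intro psd_on_inner_nonneg fin B psd_on_sub_const psdM rowM) simp_all
    \<comment> \<open>\<open>B\<close> vanishes wherever \<open>M\<close> is 1, so only the diagonal
      and the all-ones part remain.\<close>
    also have "\<dots> = (\<Sum>i\<in>V. \<Sum>j\<in>V. c * \<mu> * (B i j * of_bool (i = j)) - B i j)"
      by (intro sum.cong refl) (auto simp: M B0 E' algebra_simps)
    also have "\<dots> = c * \<mu> - (\<Sum>i\<in>V. \<Sum>j\<in>V. B i j)"
      using B(2) by (simp add: sum_subtractf diag flip: sum_distrib_left)
    also have "c * \<mu> = real (card V) / (1 + d / \<mu>)"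
      using pos by (simp add: c_def N_def field_simps)
    finally show "(\<Sum>i\<in>V. \<Sum>j\<in>V. B i j) \<le> real (card V) / (1 + d / \<mu>)"
      by simp
  qed
qed

subsection \<open>Eigenvectors of the Johnson scheme\<close>

text \<open>Signed count of exchanges of \<open>i\<close> elements when \<open>j\<close> pairs are
  separated: \<open>t\<close> pairs are swapped completely, each with sign -1, and the other
  \<open>i - t\<close> elements on either side are chosen among \<open>p\<close> and
  \<open>q\<close> unpaired ones.\<close>

definition exchange_sum :: "nat \<Rightarrow> nat \<Rightarrow> nat \<Rightarrow> nat \<Rightarrow> real" where
  "exchange_sum j i p q = (\<Sum>t\<le>i. (-1) ^ t * real (j choose t) * real (p choose (i - t)) * real (q choose (i - t)))"

text \<open>The eigenvalue of the distance-\<open>i\<close> relation on the \<open>j\<close>-th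
  eigenspace; \<open>k - j\<close> and \<open>n - k - j\<close> count the unpaired elements inside
  and outside a set.\<close>

definition eberlein :: "nat \<Rightarrow> nat \<Rightarrow> nat \<Rightarrow> nat \<Rightarrow> real" where
  "eberlein n k i j = exchange_sum j i (k - j) (n - k - j)"

lemma exchange_sum_0: "exchange_sum 0 i p q = real (p choose i) * real (q choose i)"
proof -
  have "exchange_sum 0 i p q = (\<Sum>t\<le>i. if t = 0 then real (p choose i) * real (q choose i) else 0)"
    unfolding exchange_sum_def by (intro sum.cong) auto
  then show ?thesis by simp
qed

lemma exchange_sum_zero: "exchange_sum j 0 p q = 1"
  by (simp add: exchange_sum_def)

text \<open>Pascal's rule for \<open>j choose t\<close>: the additional pair is left alone, or
  swapped at the cost of one exchange and a sign.\<close>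

lemma exchange_sum_Suc_Suc:
  "exchange_sum (Suc j) (Suc i) p q = exchange_sum j (Suc i) p q - exchange_sum j i p q"
  unfolding exchange_sum_def sum.atMost_Suc_shift
  by (simp add: algebra_simps sum.distrib sum_subtractf sum_negf)

abbreviation ksubsets :: "'a set \<Rightarrow> nat \<Rightarrow> 'a set set" where
  "ksubsets S i \<equiv> {X. X \<subseteq> S \<and> card X = i}"

lemma ksubsets_0: "finite S \<Longrightarrow> ksubsets S 0 = {{}}"
  using finite_subset by fastforce

lemma sum_ksubsets_insert:
  fixes h :: "'a set \<Rightarrow> 'b::comm_monoid_add"
  assumes "finite S" "a \<notin> S"
  shows "(\<Sum>X\<in>ksubsets (insert a S) (Suc i). h X)
    = (\<Sum>X\<in>ksubsets S (Suc i). h X) + (\<Sum>X\<in>ksubsets S i. h (insert a X))"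
proof -
  have "ksubsets (insert a S) (Suc i) = ksubsets S (Suc i) \<union> insert a ` ksubsets S i" (is "?L = ?R")
  proof
    show "?L \<subseteq> ?R"
    proof
      fix X assume X: "X \<in> ?L"
      show "X \<in> ?R"
      proof (cases "a \<in> X")
        case True
        then have "X = insert a (X - {a})" by auto
        moreover have "X - {a} \<in> ksubsets S i"
          using X True by (auto simp: card_Diff_singleton)
        ultimately show ?thesis by blast
      qed (use X in auto)
    qed
    have "card (insert a X) = Suc (card X)" if "X \<subseteq> S" for X
      using assms that by (auto intro!: card_insert_disjoint finite_subset[OF that])
    then show "?R \<subseteq> ?L" by auto
  qed
  moreover have "inj_on (insert a) (ksubsets S i)"
    using assms(2) by (intro inj_onI) (metis (mono_tags, lifting) insert_ident mem_Collect_eq subsetD)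
  moreover have "ksubsets S (Suc i) \<inter> insert a ` ksubsets S i = {}"
    using assms(2) by auto
  moreover have "finite (ksubsets S m)" for m
    using assms(1) by simp
  ultimately show ?thesis
    by (simp add: sum.union_disjoint sum.reindex)
qed

section \<open>Products of differences over disjoint pairs\<close>

primrec pair_support :: "('a \<times> 'a) list \<Rightarrow> 'a set" where
  "pair_support [] = {}"
| "pair_support (p # ps) = {fst p, snd p} \<union> pair_support ps"

primrec disjoint_pairs :: "('a \<times> 'a) list \<Rightarrow> bool" where
  "disjoint_pairs [] \<longleftrightarrow> True"
| "disjoint_pairs (p # ps) \<longleftrightarrow> fst p \<noteq> snd p \<and> {fst p, snd p} \<inter> pair_support ps = {} \<and> disjoint_pairs ps"

text \<open>For disjoint pairs the value is 1 or -1 if \<open>A\<close> separates every pair, and 0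
  otherwise.\<close>

primrec pair_prod :: "('a \<times> 'a) list \<Rightarrow> 'a set \<Rightarrow> real" where
  "pair_prod [] A = 1"
| "pair_prod (p # ps) A = (of_bool (fst p \<in> A) - of_bool (snd p \<in> A)) * pair_prod ps A"

lemma pair_prod_cong: "A \<inter> pair_support ps = B \<inter> pair_support ps \<Longrightarrow> pair_prod ps A = pair_prod ps B"
  by (induction ps) (auto simp: set_eq_iff of_bool_def)

lemma pair_support_iff: "x \<in> pair_support ps \<longleftrightarrow> (\<exists>p\<in>set ps. x = fst p \<or> x = snd p)"
  by (induction ps) auto

text \<open>Induction on the pairs. Exchanging just one element of the first pair puts both or
  neither into the new set, so the product vanishes; exchanging neither keeps the sign and
  exchanging both flips it. This is the recursion \<open>exchange_sum_Suc_Suc\<close>.\<close>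

lemma sum_pair_prod_exchange:
  assumes "disjoint_pairs ps" "finite A" "finite C" "A \<inter> C = {}"
    and "\<forall>p\<in>set ps. fst p \<in> A \<and> snd p \<in> C \<or> fst p \<in> C \<and> snd p \<in> A"
  shows "(\<Sum>X\<in>ksubsets A i. \<Sum>Y\<in>ksubsets C i. pair_prod ps ((A - X) \<union> Y))
    = pair_prod ps A * exchange_sum (length ps) i (card A - length ps) (card C - length ps)"
  using assms
proof (induction ps arbitrary: A C i)
  case Nil
  have "(\<Sum>X\<in>ksubsets A i. \<Sum>Y\<in>ksubsets C i. pair_prod [] ((A - X) \<union> Y))
      = real (card (ksubsets A i)) * real (card (ksubsets C i))"
    by simp
  then show ?case using Nil by (simp add: exchange_sum_0 n_subsets)
next
  case (Cons p ps)
  \<comment> \<open>The first pair is oriented with \<open>c\<close> in \<open>A\<close> and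
    \<open>d\<close> in \<open>C\<close>; \<open>s\<close> is the sign of a possible flip.\<close>
  obtain c d s where cd: "c \<in> A" "d \<in> C" "{fst p, snd p} = {c, d}"
    and pair: "\<And>Z. pair_prod (p # ps) Z = s * (of_bool (c \<in> Z) - of_bool (d \<in> Z)) * pair_prod ps Z"
  proof (cases "fst p \<in> A")
    case True
    then have "snd p \<in> C" using Cons.prems(4,5) by auto
    with True show ?thesis by (intro that[of "fst p" "snd p" 1]) simp_all
  next
    case False
    then have "snd p \<in> A" "fst p \<in> C" using Cons.prems(5) by auto
    then show ?thesis by (intro that[of "snd p" "fst p" "-1"]) auto
  qed
  define A' C' where "A' = A - {c}" and "C' = C - {d}"
  have A: "A = insert c A'" "c \<notin> A'" "finite A'" and C: "C = insert d C'" "d \<notin> C'" "finite C'"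
    using cd Cons.prems by (auto simp: A'_def C'_def)
  have cd': "c \<notin> C'" "d \<notin> A'" "c \<noteq> d" using Cons.prems(4) A C by auto
  have supp: "c \<notin> pair_support ps" "d \<notin> pair_support ps"
    using Cons.prems(1) cd(3) by auto
  define F where "F = (\<lambda>i. \<Sum>X\<in>ksubsets A' i. \<Sum>Y\<in>ksubsets C' i. pair_prod ps ((A' - X) \<union> Y))"
  have F: "F i = pair_prod ps A' * exchange_sum (length ps) i (card A' - length ps) (card C' - length ps)" for i
    unfolding F_def
  proof (rule Cons.IH)
    have "fst q \<in> pair_support ps" "snd q \<in> pair_support ps" if "q \<in> set ps" for q
      using that by (auto simp: pair_support_iff)
    then show "\<forall>p\<in>set ps. fst p \<in> A' \<and> snd p \<in> C' \<or> fst p \<in> C' \<and> snd p \<in> A'"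
      using Cons.prems(5) supp unfolding A'_def C'_def
      by (metis DiffI list.set_intros(2) singletonD)
  qed (use Cons.prems A C in auto)
  have pA: "pair_prod (p # ps) A = s * pair_prod ps A'"
  proof -
    have "pair_prod ps A = pair_prod ps A'"
      by (rule pair_prod_cong) (use supp in \<open>auto simp: A'_def\<close>)
    moreover have "d \<notin> A" using Cons.prems(4) cd by auto
    ultimately show ?thesis using cd(1) by (simp only: pair) simp
  qed
  show ?case
  proof (cases i)
    case 0
    then show ?thesis
      using Cons.prems(2,3) by (simp add: ksubsets_0 exchange_sum_zero del: pair_prod.simps)
  next
    case (Suc m)
    let ?g = "\<lambda>X Y. pair_prod (p # ps) ((A - X) \<union> Y)"
    have g: "?g X Y = s * pair_prod ps ((A' - X) \<union> Y)" "?g X (insert d Y) = 0"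
      "?g (insert c X) Y = 0" "?g (insert c X) (insert d Y) = - s * pair_prod ps ((A' - X) \<union> Y)"
      if "X \<subseteq> A'" "Y \<subseteq> C'" for X Y
    proof -
      have "pair_prod ps ((A - X) \<union> Y) = pair_prod ps ((A' - X) \<union> Y)"
        "pair_prod ps ((A - insert c X) \<union> insert d Y) = pair_prod ps ((A' - X) \<union> Y)"
        using supp unfolding A(1) by (auto intro!: pair_prod_cong)
      moreover have "c \<notin> X" "c \<notin> Y" "d \<notin> X" "d \<notin> Y" using that A(2) C(2) cd' by auto
      ultimately show "?g X Y = s * pair_prod ps ((A' - X) \<union> Y)" "?g X (insert d Y) = 0"
        "?g (insert c X) Y = 0" "?g (insert c X) (insert d Y) = - s * pair_prod ps ((A' - X) \<union> Y)"
        using cd' unfolding pair by (simp_all add: A(1))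
    qed
    have "(\<Sum>X\<in>ksubsets A (Suc m). \<Sum>Y\<in>ksubsets C (Suc m). ?g X Y)
        = (\<Sum>X\<in>ksubsets A' (Suc m). \<Sum>Y\<in>ksubsets C (Suc m). ?g X Y)
        + (\<Sum>X\<in>ksubsets A' m. \<Sum>Y\<in>ksubsets C (Suc m). ?g (insert c X) Y)"
      unfolding A(1) by (rule sum_ksubsets_insert[OF A(3,2)])
    also have "(\<Sum>X\<in>ksubsets A' (Suc m). \<Sum>Y\<in>ksubsets C (Suc m). ?g X Y)
        = (\<Sum>X\<in>ksubsets A' (Suc m). (\<Sum>Y\<in>ksubsets C' (Suc m). s * pair_prod ps ((A' - X) \<union> Y)) + (\<Sum>Y\<in>ksubsets C' m. 0))"
      unfolding C(1) sum_ksubsets_insert[OF C(3,2)]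
      by (intro sum.cong refl arg_cong2[where f = "(+)"]) (use g in auto)
    also have "\<dots> = s * F (Suc m)"
      by (simp add: F_def sum_distrib_left)
    also have "(\<Sum>X\<in>ksubsets A' m. \<Sum>Y\<in>ksubsets C (Suc m). ?g (insert c X) Y)
        = (\<Sum>X\<in>ksubsets A' m. (\<Sum>Y\<in>ksubsets C' (Suc m). 0) + (\<Sum>Y\<in>ksubsets C' m. - s * pair_prod ps ((A' - X) \<union> Y)))"
      unfolding C(1) sum_ksubsets_insert[OF C(3,2)]
      by (intro sum.cong refl arg_cong2[where f = "(+)"]) (use g in auto)
    also have "\<dots> = - s * F m"
      by (simp add: F_def sum_distrib_left sum_negf)
    finally have "(\<Sum>X\<in>ksubsets A i. \<Sum>Y\<in>ksubsets C i. ?g X Y) = s * F (Suc m) + - s * F m"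
      by (simp only: Suc)
    then show ?thesis
      unfolding pA F Suc using A C by (simp add: exchange_sum_Suc_Suc algebra_simps)
  qed
qed

section \<open>Johnson vertices under permutations\<close>

lemma finite_johnson_vertices: "finite (johnson_vertices n k)"
  unfolding johnson_vertices_def by simp

lemma card_johnson_vertices: "card (johnson_vertices n k) = n choose k"
  unfolding johnson_vertices_def by (simp add: n_subsets)

lemma johnson_verticesD:
  assumes "A \<in> johnson_vertices n k"
  shows "A \<subseteq> {1..n}" "card A = k" "finite A"
  using assms finite_subset[of A "{1..n}"] by (auto simp: johnson_vertices_def)

lemma card_diff_commute: "finite A \<Longrightarrow> finite B \<Longrightarrow> card A = card B \<Longrightarrow> card (A - B) = card (B - A)"
  by (simp add: card_Diff_subset_Int Int_commute)

lemma transpose_image_iff: "x \<in> Transposition.transpose a b ` B \<longleftrightarrow> Transposition.transpose a b x \<in> B"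
  by (metis image_iff transpose_involutory)

text \<open>The transposition interchanges the two indicators of its own pair and, by disjointness,
  fixes all other pairs.\<close>

lemma pair_prod_transpose:
  assumes "disjoint_pairs ps" "p \<in> set ps"
  shows "pair_prod ps (Transposition.transpose (fst p) (snd p) ` B) = - pair_prod ps B"
  using assms
proof (induction ps)
  case (Cons q ps)
  show ?case
  proof (cases "p = q")
    case True
    have "Transposition.transpose (fst p) (snd p) ` B \<inter> pair_support ps = B \<inter> pair_support ps"
    proof (intro set_eqI)
      fix x
      have "Transposition.transpose (fst p) (snd p) x = x" if "x \<in> pair_support ps"
        using Cons.prems(1) True that by (intro transpose_apply_other) auto
      then show "x \<in> Transposition.transpose (fst p) (snd p) ` B \<inter> pair_support ps \<longleftrightarrow> x \<in> B \<inter> pair_support ps"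
        by (auto simp only: Int_iff transpose_image_iff)
    qed
    from pair_prod_cong[OF this] show ?thesis
      using True by (simp add: transpose_image_iff algebra_simps)
  next
    case False
    then have p: "p \<in> set ps" using Cons.prems by simp
    then have "fst p \<in> pair_support ps" "snd p \<in> pair_support ps"
      by (auto simp: pair_support_iff)
    then have "fst q \<noteq> fst p" "fst q \<noteq> snd p" "snd q \<noteq> fst p" "snd q \<noteq> snd p"
      using Cons.prems(1) by auto
    then have "Transposition.transpose (fst p) (snd p) (fst q) = fst q"
      "Transposition.transpose (fst p) (snd p) (snd q) = snd q"
      by (simp_all add: transpose_apply_other)
    then show ?thesis using Cons.IH p Cons.prems by (simp add: transpose_image_iff)
  qed
qed simp

lemma permutes_image_johnson_vertices:
  assumes "\<sigma> permutes {1..n}" "A \<in> johnson_vertices n k"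
  shows "\<sigma> ` A \<in> johnson_vertices n k"
proof -
  have "\<sigma> ` A \<subseteq> {1..n}"
    using assms johnson_verticesD(1) permutes_image by (metis image_mono)
  moreover have "card (\<sigma> ` A) = card A"
    by (rule card_image) (use assms(1) permutes_inj_on in blast)
  ultimately show ?thesis using johnson_verticesD(2)[OF assms(2)] by (simp add: johnson_vertices_def)
qed

lemma sum_johnson_vertices_permutes:
  assumes "\<sigma> permutes {1..n}"
  shows "(\<Sum>A\<in>johnson_vertices n k. g (\<sigma> ` A)) = (\<Sum>A\<in>johnson_vertices n k. g A)"
  by (rule sum.reindex_bij_witness[where i = "\<lambda>A. inv \<sigma> ` A" and j = "\<lambda>A. \<sigma> ` A"])
     (auto simp: image_comp permutes_inv_o[OF assms]
       intro: permutes_image_johnson_vertices assms permutes_inv)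

lemma card_permutes_image_diff:
  assumes "\<sigma> permutes S"
  shows "card (\<sigma> ` A - \<sigma> ` B) = card (A - B)"
proof -
  have "\<sigma> ` A - \<sigma> ` B = \<sigma> ` (A - B)"
    using permutes_inj[OF assms] by (simp add: image_set_diff)
  then show ?thesis
    by (metis assms card_image permutes_inj_on)
qed

text \<open>An eigenvector of all distance relations at once. The zero function qualifies, so
  components of a decomposition may be zero.\<close>

definition johnson_eigenvector :: "nat \<Rightarrow> nat \<Rightarrow> nat \<Rightarrow> (nat set \<Rightarrow> real) \<Rightarrow> bool" where
  "johnson_eigenvector n k j v \<longleftrightarrow> (\<forall>i. \<forall>A\<in>johnson_vertices n k.
     (\<Sum>B\<in>johnson_vertices n k. of_bool (card (A - B) = i) * v B) = eberlein n k i j * v A)"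

lemma johnson_eigenvectorD:
  "johnson_eigenvector n k j v \<Longrightarrow> A \<in> johnson_vertices n k \<Longrightarrow>
    (\<Sum>B\<in>johnson_vertices n k. of_bool (card (A - B) = i) * v B) = eberlein n k i j * v A"
  by (simp add: johnson_eigenvector_def)

text \<open>A \<open>k\<close>-set at distance \<open>i\<close> from \<open>A\<close> is determined
  by what it drops from \<open>A\<close> and what it adds, two independent choices of
  \<open>i\<close> elements.\<close>

lemma sum_johnson_distance:
  assumes A: "A \<in> johnson_vertices n k"
  shows "(\<Sum>B\<in>johnson_vertices n k. of_bool (card (A - B) = i) * h B)
    = (\<Sum>X\<in>ksubsets A i. \<Sum>Y\<in>ksubsets ({1..n} - A) i. h ((A - X) \<union> Y) :: real)"
proof -
  note A' = johnson_verticesD[OF A]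
  have "(\<Sum>B\<in>johnson_vertices n k. of_bool (card (A - B) = i) * h B)
      = (\<Sum>B\<in>{B \<in> johnson_vertices n k. card (A - B) = i}. h B)"
    by (rule sum.mono_neutral_cong_right) (auto simp: finite_johnson_vertices)
  also have "\<dots> = (\<Sum>(X, Y)\<in>ksubsets A i \<times> ksubsets ({1..n} - A) i. h ((A - X) \<union> Y))"
  proof (rule sum.reindex_bij_witness[where i = "\<lambda>(X, Y). (A - X) \<union> Y" and j = "\<lambda>B. (A - B, B - A)"])
    fix B assume "B \<in> {B \<in> johnson_vertices n k. card (A - B) = i}"
    then have B: "B \<subseteq> {1..n}" "card B = k" "finite B" "card (A - B) = i"
      using johnson_verticesD by auto
    then show "(A - B, B - A) \<in> ksubsets A i \<times> ksubsets ({1..n} - A) i"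
      using card_diff_commute[OF A'(3) B(3)] A' by auto
    have eq: "A - (A - B) \<union> (B - A) = B" by auto
    then show "(case (A - B, B - A) of (X, Y) \<Rightarrow> A - X \<union> Y) = B"
      "(case (A - B, B - A) of (X, Y) \<Rightarrow> h (A - X \<union> Y)) = h B"
      by simp_all
  next
    fix XY assume XY: "XY \<in> ksubsets A i \<times> ksubsets ({1..n} - A) i"
    obtain X Y where [simp]: "XY = (X, Y)" by fastforce
    from XY have X: "X \<subseteq> A" "card X = i" and Y: "Y \<subseteq> {1..n} - A" "card Y = i" by auto
    have fin: "finite X" "finite Y" using X Y A'(3) finite_subset by (blast, fastforce)
    have "card (A - X \<union> Y) = card (A - X) + card Y"
      using X Y fin A'(3) by (intro card_Un_disjoint) auto
    also have "\<dots> = k"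
      using X Y fin A' card_mono[OF A'(3) X(1)] by (simp add: card_Diff_subset)
    finally have "card (A - X \<union> Y) = k" .
    moreover have *: "A - (A - X \<union> Y) = X" "A - X \<union> Y - A = Y" using X Y by auto
    ultimately show "(case XY of (X, Y) \<Rightarrow> A - X \<union> Y) \<in> {B \<in> johnson_vertices n k. card (A - B) = i}"
      using X Y A'(1) by (auto simp: johnson_vertices_def)
    show "(A - (case XY of (X, Y) \<Rightarrow> A - X \<union> Y), (case XY of (X, Y) \<Rightarrow> A - X \<union> Y) - A) = XY"
      using * by simp
  qed
  finally show ?thesis by (simp add: sum.cartesian_product)
qed

text \<open>If a pair is not separated by \<open>A\<close>, its transposition fixes \<open>A\<close> and negates the product,
  so both sides vanish.\<close>

lemma johnson_eigenvector_pair_prod: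
  assumes ps: "disjoint_pairs ps" and supp: "pair_support ps \<subseteq> {1..n}"
  shows "johnson_eigenvector n k (length ps) (pair_prod ps)"
  unfolding johnson_eigenvector_def
proof (intro allI ballI)
  fix i A assume A: "A \<in> johnson_vertices n k"
  note A' = johnson_verticesD[OF A]
  let ?V = "johnson_vertices n k"
  have pairs: "fst p \<in> {1..n}" "snd p \<in> {1..n}" if "p \<in> set ps" for p
  proof -
    have "fst p \<in> pair_support ps" "snd p \<in> pair_support ps"
      using that by (auto simp: pair_support_iff)
    then show "fst p \<in> {1..n}" "snd p \<in> {1..n}" using supp by blast+
  qed
  show "(\<Sum>B\<in>?V. of_bool (card (A - B) = i) * pair_prod ps B) = eberlein n k i (length ps) * pair_prod ps A"
  proof (cases "\<forall>p\<in>set ps. fst p \<in> A \<longleftrightarrow> snd p \<notin> A")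
    case True
    have "(\<Sum>X\<in>ksubsets A i. \<Sum>Y\<in>ksubsets ({1..n} - A) i. pair_prod ps ((A - X) \<union> Y))
      = pair_prod ps A * exchange_sum (length ps) i (card A - length ps) (card ({1..n} - A) - length ps)"
    proof (rule sum_pair_prod_exchange[OF ps])
      show "\<forall>p\<in>set ps. fst p \<in> A \<and> snd p \<in> {1..n} - A \<or> fst p \<in> {1..n} - A \<and> snd p \<in> A"
        using True pairs by blast
    qed (use A' in auto)
    then show ?thesis
      using A' by (simp add: sum_johnson_distance[OF A] eberlein_def card_Diff_subset)
  next
    case False
    then obtain p where p: "p \<in> set ps" "fst p \<in> A \<longleftrightarrow> snd p \<in> A" by blast
    define \<tau> where "\<tau> = Transposition.transpose (fst p) (snd p)"
    have perm: "\<tau> permutes {1..n}"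
      unfolding \<tau>_def using pairs[OF p(1)] by (rule permutes_swap_id)
    have fix_A: "\<tau> ` A = A"
      unfolding \<tau>_def using p(2) by (rule transpose_image_eq)
    have neg: "pair_prod ps (\<tau> ` B) = - pair_prod ps B" for B
      unfolding \<tau>_def by (rule pair_prod_transpose[OF ps p(1)])
    have "(\<Sum>B\<in>?V. of_bool (card (A - B) = i) * pair_prod ps B)
        = (\<Sum>B\<in>?V. of_bool (card (A - \<tau> ` B) = i) * pair_prod ps (\<tau> ` B))"
      by (rule sum_johnson_vertices_permutes[OF perm, symmetric])
    also have "\<dots> = - (\<Sum>B\<in>?V. of_bool (card (A - B) = i) * pair_prod ps B)"
      using card_permutes_image_diff[OF perm, of A] by (simp add: fix_A neg sum_negf)
    finally have "(\<Sum>B\<in>?V. of_bool (card (A - B) = i) * pair_prod ps B) = 0" by simp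
    moreover have "pair_prod ps A = 0" using neg[of A] fix_A by simp
    ultimately show ?thesis by simp
  qed
qed

section \<open>The eigenvectors span all functions on the vertices\<close>

definition johnson_decomposable :: "nat \<Rightarrow> nat \<Rightarrow> (nat set \<Rightarrow> real) \<Rightarrow> bool" where
  "johnson_decomposable n k x \<longleftrightarrow> (\<exists>v. (\<forall>j\<le>k. johnson_eigenvector n k j (v j)) \<and>
     (\<forall>A\<in>johnson_vertices n k. x A = (\<Sum>j\<le>k. v j A)))"

lemma johnson_eigenvector_zero: "johnson_eigenvector n k j (\<lambda>_. 0)"
  by (simp add: johnson_eigenvector_def)

lemma johnson_eigenvector_add:
  "johnson_eigenvector n k j v \<Longrightarrow> johnson_eigenvector n k j w \<Longrightarrow> johnson_eigenvector n k j (\<lambda>A. v A + w A)"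
  by (simp add: johnson_eigenvector_def distrib_left sum.distrib)

lemma johnson_eigenvector_cmult:
  assumes "johnson_eigenvector n k j v"
  shows "johnson_eigenvector n k j (\<lambda>A. c * v A)"
proof -
  have "(\<Sum>B\<in>johnson_vertices n k. of_bool (card (A - B) = i) * (c * v B))
      = c * (\<Sum>B\<in>johnson_vertices n k. of_bool (card (A - B) = i) * v B)" for A i
    by (simp add: sum_distrib_left mult.left_commute)
  then show ?thesis using assms by (simp add: johnson_eigenvector_def mult.left_commute)
qed

lemma johnson_decomposable_zero: "johnson_decomposable n k (\<lambda>_. 0)"
  unfolding johnson_decomposable_def
  by (rule exI[of _ "\<lambda>_ _. 0"]) (simp add: johnson_eigenvector_zero)

lemma johnson_decomposable_add:
  assumes "johnson_decomposable n k x" "johnson_decomposable n k y"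
  shows "johnson_decomposable n k (\<lambda>A. x A + y A)"
proof -
  from assms obtain v w where
    "\<forall>j\<le>k. johnson_eigenvector n k j (v j)" "\<forall>A\<in>johnson_vertices n k. x A = (\<Sum>j\<le>k. v j A)"
    "\<forall>j\<le>k. johnson_eigenvector n k j (w j)" "\<forall>A\<in>johnson_vertices n k. y A = (\<Sum>j\<le>k. w j A)"
    unfolding johnson_decomposable_def by blast
  then show ?thesis
    unfolding johnson_decomposable_def
    by (intro exI[of _ "\<lambda>j A. v j A + w j A"]) (simp add: johnson_eigenvector_add sum.distrib)
qed

lemma johnson_decomposable_cmult:
  assumes "johnson_decomposable n k x"
  shows "johnson_decomposable n k (\<lambda>A. c * x A)"
proof -
  from assms obtain v where
    "\<forall>j\<le>k. johnson_eigenvector n k j (v j)" "\<forall>A\<in>johnson_vertices n k. x A = (\<Sum>j\<le>k. v j A)"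
    unfolding johnson_decomposable_def by blast
  then show ?thesis
    unfolding johnson_decomposable_def
    by (intro exI[of _ "\<lambda>j A. c * v j A"]) (simp add: johnson_eigenvector_cmult sum_distrib_left)
qed

lemma johnson_decomposable_sum:
  "(\<And>t. t \<in> T \<Longrightarrow> johnson_decomposable n k (x t)) \<Longrightarrow> johnson_decomposable n k (\<lambda>A. \<Sum>t\<in>T. x t A)"
  by (induction T rule: infinite_finite_induct) (simp_all add: johnson_decomposable_zero johnson_decomposable_add)

lemma johnson_decomposable_cong:
  "johnson_decomposable n k x \<Longrightarrow> (\<And>A. A \<in> johnson_vertices n k \<Longrightarrow> y A = x A) \<Longrightarrow> johnson_decomposable n k y"
  by (simp add: johnson_decomposable_def)

lemma johnson_decomposable_pair_prod:
  assumes "disjoint_pairs ps" "pair_support ps \<subseteq> {1..n}" "length ps \<le> k"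
  shows "johnson_decomposable n k (pair_prod ps)"
  unfolding johnson_decomposable_def
proof (intro exI conjI allI impI ballI)
  fix j
  show "johnson_eigenvector n k j (if j = length ps then pair_prod ps else (\<lambda>_. 0))"
    using johnson_eigenvector_pair_prod[OF assms(1,2)] by (simp add: johnson_eigenvector_zero)
next
  fix A
  show "pair_prod ps A = (\<Sum>j\<le>k. (if j = length ps then pair_prod ps else (\<lambda>_. 0)) A)"
    using assms(3) by (simp add: if_distribR)
qed

lemma finite_pair_support: "finite (pair_support ps)"
  by (induction ps) auto

text \<open>A nonzero product forces exactly one element of each pair into \<open>A\<close>; this
  fixes how many elements \<open>A\<close> has elsewhere.\<close>

lemma card_Int_pair_support:
  assumes "disjoint_pairs ps" "pair_prod ps A \<noteq> 0"
  shows "card (A \<inter> pair_support ps) = length ps"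
  using assms
proof (induction ps)
  case (Cons p ps)
  then have "fst p \<in> A \<longleftrightarrow> snd p \<notin> A" by (auto simp: of_bool_def split: if_splits)
  then have "A \<inter> pair_support (p # ps) = insert (if fst p \<in> A then fst p else snd p) (A \<inter> pair_support ps)"
    by auto
  moreover have "(if fst p \<in> A then fst p else snd p) \<notin> A \<inter> pair_support ps"
    using Cons.prems by auto
  ultimately show ?case
    using Cons by (simp add: finite_pair_support)
qed simp

text \<open>Averaging over the unused elements \<open>F\<close> replaces one indicator factor \<open>c \<in> B\<close> by differences
  \<open>(c \<in> B) - (d \<in> B)\<close> plus a constant, because the number of elements of \<open>F\<close> in \<open>B\<close> is determined
  wherever the rest of the product does not vanish.\<close>

lemma johnson_decomposable_monomial:
  assumes "disjoint_pairs ps" "finite S" "pair_support ps \<subseteq> {1..n}" "S \<subseteq> {1..n}"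
    "S \<inter> pair_support ps = {}" "length ps + card S \<le> k"
  shows "johnson_decomposable n k (\<lambda>B. pair_prod ps B * of_bool (S \<subseteq> B))"
  using assms(2,1,3-)
proof (induction S arbitrary: ps rule: finite_induct)
  case empty
  then show ?case using johnson_decomposable_pair_prod by simp
next
  case (insert c S)
  \<comment> \<open>The possible partners of \<open>c\<close>, together with \<open>c\<close>
    itself.\<close>
  define F where "F = {1..n} - pair_support ps - S"
  have F: "finite F" "c \<in> F" using insert.prems insert.hyps by (auto simp: F_def)
  have len: "length ps + card S + 1 \<le> k" using insert.prems insert.hyps by simp
  \<comment> \<open>Trading \<open>c\<close> for the pair \<open>(c, d)\<close> lengthens the list
    by one and shrinks the set by one, so the bound by \<open>k\<close> is kept.\<close>
  have diff: "johnson_decomposable n k (\<lambda>B. pair_prod ((c, d) # ps) B * of_bool (S \<subseteq> B))" if "d \<in> F - {c}" for d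
  proof (rule insert.IH)
    show "disjoint_pairs ((c, d) # ps)" "pair_support ((c, d) # ps) \<subseteq> {1..n}"
      "S \<inter> pair_support ((c, d) # ps) = {}"
      using that insert.prems insert.hyps by (auto simp: F_def)
  qed (use insert.prems len in auto)
  have rest: "johnson_decomposable n k (\<lambda>B. pair_prod ps B * of_bool (S \<subseteq> B))"
    using insert.prems len by (intro insert.IH) auto
  \<comment> \<open>The number of elements of \<open>F\<close> in \<open>B\<close> wherever the
    monomial does not vanish.\<close>
  define m where "m = real k - real (length ps) - real (card S)"
  have "johnson_decomposable n k (\<lambda>B. 1 / real (card F) *
      ((\<Sum>d\<in>F - {c}. pair_prod ((c, d) # ps) B * of_bool (S \<subseteq> B)) + m * (pair_prod ps B * of_bool (S \<subseteq> B))))"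
    by (intro johnson_decomposable_cmult johnson_decomposable_add johnson_decomposable_sum diff rest)
  then show ?case
  proof (rule johnson_decomposable_cong)
    fix B assume B: "B \<in> johnson_vertices n k"
    note B' = johnson_verticesD[OF B]
    let ?w = "pair_prod ps B * of_bool (S \<subseteq> B)"
    have count: "?w * real (card (B \<inter> F)) = ?w * m"
    proof (cases "?w = 0")
      case False
      then have nz: "pair_prod ps B \<noteq> 0" and S: "S \<subseteq> B" by (auto split: if_splits)
      have "B = (B \<inter> pair_support ps) \<union> S \<union> (B \<inter> F)"
        using B' S by (auto simp: F_def)
      moreover have "card ((B \<inter> pair_support ps) \<union> S \<union> (B \<inter> F)) = card (B \<inter> pair_support ps) + card S + card (B \<inter> F)"
      proof -
        have "B \<inter> pair_support ps \<inter> S = {}" using insert.prems(4) by auto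
        moreover have "(B \<inter> pair_support ps \<union> S) \<inter> (B \<inter> F) = {}" by (auto simp: F_def)
        ultimately show ?thesis
          using insert.hyps(1) B'(3) by (simp add: card_Un_disjoint)
      qed
      ultimately have "k = length ps + card S + card (B \<inter> F)"
        using B'(2) card_Int_pair_support[OF insert.prems(1) nz] by simp
      then show ?thesis by (simp add: m_def)
    qed simp
    \<comment> \<open>The term for \<open>d = c\<close> is zero.\<close>
    have "(\<Sum>d\<in>F - {c}. of_bool (c \<in> B) - of_bool (d \<in> B)) = (\<Sum>d\<in>F. of_bool (c \<in> B) - of_bool (d \<in> B) :: real)"
      using F by (simp add: sum.remove)
    also have "\<dots> = real (card F) * of_bool (c \<in> B) - real (card (B \<inter> F))"
      using F(1) by (simp add: sum_subtractf sum.If_cases of_bool_def Int_commute Int_def)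
    finally have avg: "(\<Sum>d\<in>F - {c}. of_bool (c \<in> B) - of_bool (d \<in> B))
        = real (card F) * of_bool (c \<in> B) - real (card (B \<inter> F))" .
    have "(\<Sum>d\<in>F - {c}. pair_prod ((c, d) # ps) B * of_bool (S \<subseteq> B))
        = (\<Sum>d\<in>F - {c}. ?w * (of_bool (c \<in> B) - of_bool (d \<in> B)))"
      by (intro sum.cong refl) (simp add: mult_ac)
    then have "(\<Sum>d\<in>F - {c}. pair_prod ((c, d) # ps) B * of_bool (S \<subseteq> B))
        = ?w * (real (card F) * of_bool (c \<in> B) - real (card (B \<inter> F)))"
      by (simp only: avg flip: sum_distrib_left)
    then have "(\<Sum>d\<in>F - {c}. pair_prod ((c, d) # ps) B * of_bool (S \<subseteq> B)) + m * ?w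
        = real (card F) * (?w * of_bool (c \<in> B))"
      using count by (simp only: right_diff_distrib) (simp add: mult_ac)
    moreover have "real (card F) \<noteq> 0" using F by auto
    moreover have "?w * of_bool (c \<in> B) = pair_prod ps B * of_bool (insert c S \<subseteq> B)" by (simp add: of_bool_def)
    ultimately show "pair_prod ps B * of_bool (insert c S \<subseteq> B) = 1 / real (card F) *
        ((\<Sum>d\<in>F - {c}. pair_prod ((c, d) # ps) B * of_bool (S \<subseteq> B)) + m * ?w)"
      by (simp del: pair_prod.simps)
  qed
qed

text \<open>Among sets of equal size \<open>A \<subseteq> B\<close> means \<open>A = B\<close>, so
  monomials without pairs are the indicators of single vertices.\<close>

lemma johnson_decomposable_all: "johnson_decomposable n k x"
proof -
  let ?V = "johnson_vertices n k"
  have "johnson_decomposable n k (\<lambda>B. pair_prod [] B * of_bool (A \<subseteq> B))" if "A \<in> ?V" for A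
    by (rule johnson_decomposable_monomial) (use johnson_verticesD[OF that] in auto)
  then have "johnson_decomposable n k (\<lambda>B. \<Sum>A\<in>?V. x A * (pair_prod [] B * of_bool (A \<subseteq> B)))"
    by (intro johnson_decomposable_sum johnson_decomposable_cmult)
  then show ?thesis
  proof (rule johnson_decomposable_cong)
    fix B assume B: "B \<in> ?V"
    have "A \<subseteq> B \<longleftrightarrow> A = B" if "A \<in> ?V" for A
      using card_subset_eq[of B A] johnson_verticesD[OF B] johnson_verticesD[OF that] by auto
    then have "(\<Sum>A\<in>?V. x A * (pair_prod [] B * of_bool (A \<subseteq> B))) = (\<Sum>A\<in>?V. if A = B then x A else 0)"
      by (intro sum.cong refl) simp
    then show "x B = (\<Sum>A\<in>?V. x A * (pair_prod [] B * of_bool (A \<subseteq> B)))"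
      using B by (simp add: finite_johnson_vertices)
  qed
qed

subsection \<open>Certificates in the Johnson scheme\<close>

lemma eberlein_1:
  assumes "j \<le> k" "2 * k \<le> n"
  shows "eberlein n k 1 j = real k * (real n - real k) + real j * (real j - 1 - real n)"
proof -
  have "eberlein n k 1 j = real (k - j) * real (n - k - j) - real j"
    by (simp add: eberlein_def exchange_sum_def)
  also have "real (n - k - j) = real n - real k - real j"
    using assms by (simp add: of_nat_diff)
  finally show ?thesis using assms by (simp add: of_nat_diff algebra_simps)
qed

text \<open>The difference factors as \<open>(j - j') * (j + j' - 1 - n)\<close>, and
  \<open>j + j' \<le> 2 * k \<le> n\<close> keeps the second factor nonzero. Distance one alone thus
  tells the eigenspaces apart.\<close>

lemma eberlein_1_inj:
  assumes "j \<le> k" "j' \<le> k" "j \<noteq> j'" "2 * k \<le> n"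
  shows "eberlein n k 1 j \<noteq> eberlein n k 1 j'"
proof
  assume "eberlein n k 1 j = eberlein n k 1 j'"
  then have "(real j - real j') * (real j + real j' - 1 - real n) = 0"
    using assms by (simp add: eberlein_1 algebra_simps del: One_nat_def)
  then have "real j = real j' \<or> real j + real j' = 1 + real n" by (simp only: mult_eq_0_iff) linarith
  then show False using assms by linarith
qed

lemma eberlein_0_right: "eberlein n k i 0 = real (k choose i) * real ((n - k) choose i)"
  by (simp add: eberlein_def exchange_sum_0)

lemma johnson_distance_commute:
  assumes "A \<in> johnson_vertices n k" "B \<in> johnson_vertices n k"
  shows "card (A - B) = card (B - A)"
  using johnson_verticesD[OF assms(1)] johnson_verticesD[OF assms(2)] by (intro card_diff_commute) auto

text \<open>Moving the symmetric distance-one matrix from one factor to the other compares two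
  different eigenvalues.\<close>

lemma johnson_eigenvectors_orthogonal:
  assumes v: "johnson_eigenvector n k j v" and w: "johnson_eigenvector n k j' w"
    and "j \<le> k" "j' \<le> k" "j \<noteq> j'" "2 * k \<le> n"
  shows "(\<Sum>A\<in>johnson_vertices n k. v A * w A) = 0"
proof -
  let ?V = "johnson_vertices n k"
  have "eberlein n k 1 j * (\<Sum>A\<in>?V. v A * w A)
      = (\<Sum>A\<in>?V. (\<Sum>B\<in>?V. of_bool (card (A - B) = 1) * v B) * w A)"
    by (simp only: johnson_eigenvectorD[OF v] sum_distrib_left mult.assoc cong: sum.cong)
  also have "\<dots> = (\<Sum>A\<in>?V. \<Sum>B\<in>?V. of_bool (card (A - B) = 1) * v B * w A)"
    by (simp only: sum_distrib_right)
  also have "\<dots> = (\<Sum>B\<in>?V. \<Sum>A\<in>?V. of_bool (card (A - B) = 1) * v B * w A)"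
    by (rule sum.swap)
  also have "\<dots> = (\<Sum>B\<in>?V. v B * (\<Sum>A\<in>?V. of_bool (card (B - A) = 1) * w A))"
    by (intro sum.cong refl) (simp add: sum_distrib_left mult_ac johnson_distance_commute[of _ n k] cong: sum.cong)
  also have "\<dots> = eberlein n k 1 j' * (\<Sum>A\<in>?V. v A * w A)"
    by (simp only: johnson_eigenvectorD[OF w] sum_distrib_left mult.left_commute cong: sum.cong)
  finally show ?thesis using eberlein_1_inj[OF assms(3-6)] by simp
qed

text \<open>Decomposing \<open>x\<close> into orthogonal eigenvectors removes the cross terms; the
  form becomes a sum of squared norms with weights \<open>eberlein n k i j + \<mu>\<close>.\<close>

lemma psd_on_johnson_distance:
  assumes n: "2 * k \<le> n" and \<mu>: "\<And>j. j \<le> k \<Longrightarrow> - \<mu> \<le> eberlein n k i j"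
  shows "psd_on (johnson_vertices n k) (\<lambda>A B. of_bool (card (A - B) = i) + \<mu> * of_bool (A = B))"
  unfolding psd_on_def
proof (intro conjI ballI allI)
  fix A B assume "A \<in> johnson_vertices n k" "B \<in> johnson_vertices n k"
  then show "of_bool (card (A - B) = i) + \<mu> * of_bool (A = B) = of_bool (card (B - A) = i) + \<mu> * of_bool (B = A)"
    using johnson_distance_commute[of A n k B] by (simp add: eq_commute)
next
  fix x
  let ?V = "johnson_vertices n k"
  obtain v where v: "\<And>j. j \<le> k \<Longrightarrow> johnson_eigenvector n k j (v j)"
    and x: "\<And>A. A \<in> ?V \<Longrightarrow> x A = (\<Sum>j\<le>k. v j A)"
    using johnson_decomposable_all[of n k x] unfolding johnson_decomposable_def by blast
  have row: "(\<Sum>B\<in>?V. (of_bool (card (A - B) = i) + \<mu> * of_bool (A = B)) * x B)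
      = (\<Sum>j\<le>k. (eberlein n k i j + \<mu>) * v j A)" if A: "A \<in> ?V" for A
  proof -
    have "(\<Sum>B\<in>?V. (of_bool (card (A - B) = i) + \<mu> * of_bool (A = B)) * x B)
        = (\<Sum>B\<in>?V. of_bool (card (A - B) = i) * x B) + (\<Sum>B\<in>?V. if A = B then \<mu> * x B else 0)"
      by (simp only: sum.distrib[symmetric]) (intro sum.cong refl, simp add: algebra_simps)
    also have "(\<Sum>B\<in>?V. if A = B then \<mu> * x B else 0) = \<mu> * x A"
      using A by (simp add: finite_johnson_vertices)
    also have "(\<Sum>B\<in>?V. of_bool (card (A - B) = i) * x B)
        = (\<Sum>B\<in>?V. \<Sum>j\<le>k. of_bool (card (A - B) = i) * v j B)"
      by (intro sum.cong refl) (simp only: x sum_distrib_left)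
    also have "\<dots> = (\<Sum>j\<le>k. \<Sum>B\<in>?V. of_bool (card (A - B) = i) * v j B)"
      by (rule sum.swap)
    also have "\<dots> = (\<Sum>j\<le>k. eberlein n k i j * v j A)"
      by (intro sum.cong refl johnson_eigenvectorD v A) simp
    finally show ?thesis
      by (simp add: x[OF A] sum_distrib_left distrib_right sum.distrib)
  qed
  have "(\<Sum>A\<in>?V. \<Sum>B\<in>?V. x A * (of_bool (card (A - B) = i) + \<mu> * of_bool (A = B)) * x B)
      = (\<Sum>A\<in>?V. x A * (\<Sum>j\<le>k. (eberlein n k i j + \<mu>) * v j A))"
    by (intro sum.cong refl) (simp only: mult.assoc row flip: sum_distrib_left)
  also have "\<dots> = (\<Sum>A\<in>?V. \<Sum>j\<le>k. \<Sum>j'\<le>k. (eberlein n k i j + \<mu>) * (v j A * v j' A))"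
  proof (intro sum.cong refl)
    fix A assume A: "A \<in> ?V"
    have "x A * (\<Sum>j\<le>k. (eberlein n k i j + \<mu>) * v j A) = (\<Sum>j\<le>k. (eberlein n k i j + \<mu>) * v j A) * (\<Sum>j\<le>k. v j A)"
      by (simp only: x[OF A] mult.commute)
    then show "x A * (\<Sum>j\<le>k. (eberlein n k i j + \<mu>) * v j A) = (\<Sum>j\<le>k. \<Sum>j'\<le>k. (eberlein n k i j + \<mu>) * (v j A * v j' A))"
      by (simp only: sum_product mult.assoc)
  qed
  also have "\<dots> = (\<Sum>j\<le>k. \<Sum>j'\<le>k. \<Sum>A\<in>?V. (eberlein n k i j + \<mu>) * (v j A * v j' A))"
    by (subst sum.swap) (intro sum.cong refl sum.swap)
  also have "\<dots> = (\<Sum>j\<le>k. \<Sum>j'\<le>k. if j = j' then (eberlein n k i j + \<mu>) * (\<Sum>A\<in>?V. v j A * v j A) else 0)"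
    by (intro sum.cong refl)
       (auto simp: johnson_eigenvectors_orthogonal[OF v v] n simp flip: sum_distrib_left)
  also have "\<dots> = (\<Sum>j\<le>k. (eberlein n k i j + \<mu>) * (\<Sum>A\<in>?V. v j A * v j A))"
    by simp
  also have "0 \<le> \<dots>"
  proof (rule sum_nonneg)
    fix j assume "j \<in> {..k}"
    then have "0 \<le> eberlein n k i j + \<mu>" using \<mu>[of j] by simp
    then show "0 \<le> (eberlein n k i j + \<mu>) * (\<Sum>A\<in>?V. v j A * v j A)"
      by (intro mult_nonneg_nonneg sum_nonneg zero_le_square)
  qed
  finally show "0 \<le> (\<Sum>A\<in>?V. \<Sum>B\<in>?V. x A * (of_bool (card (A - B) = i) + \<mu> * of_bool (A = B)) * x B)" .
qed

section \<open>Averaging over the symmetric group\<close>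

lemma bij_betw_subset_onto:
  assumes "finite A" "finite A'" "card A = card A'" "S \<subseteq> A" "S' \<subseteq> A'" "card S = card S'"
  obtains f where "bij_betw f A A'" "f ` S = S'"
proof -
  have fin: "finite S" "finite S'" using assms finite_subset by auto
  obtain g where g: "bij_betw g S S'"
    using finite_same_card_bij[OF fin assms(6)] by blast
  have "card (A - S) = card (A' - S')"
    using assms fin by (simp add: card_Diff_subset)
  then obtain h where h: "bij_betw h (A - S) (A' - S')"
    using finite_same_card_bij assms(1,2) by (metis finite_Diff)
  let ?f = "\<lambda>x. if x \<in> S then g x else h x"
  have "bij_betw ?f (S \<union> (A - S)) (S' \<union> (A' - S'))"
    by (rule bij_betw_disjoint_Un[OF g h]) auto
  moreover have "S \<union> (A - S) = A" "S' \<union> (A' - S') = A'" using assms by auto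
  moreover have "?f ` S = S'" using g by (auto simp: bij_betw_def)
  ultimately show ?thesis using that by metis
qed

text \<open>The permutation is glued from a bijection of \<open>A\<close> onto \<open>A'\<close>
  respecting the intersections and one of the complements respecting \<open>B - A\<close> and
  \<open>B' - A'\<close>.\<close>

lemma permutes_onto_pair:
  assumes "finite U" "A \<subseteq> U" "B \<subseteq> U" "A' \<subseteq> U" "B' \<subseteq> U"
    "card A = card A'" "card B = card B'" "card (A \<inter> B) = card (A' \<inter> B')"
  obtains \<sigma> where "\<sigma> permutes U" "\<sigma> ` A = A'" "\<sigma> ` B = B'"
proof -
  have fin: "finite A" "finite B" "finite A'" "finite B'" using assms finite_subset by blast+
  obtain f where f: "bij_betw f A A'" "f ` (A \<inter> B) = A' \<inter> B'"
    using bij_betw_subset_onto[of A A' "A \<inter> B" "A' \<inter> B'"] fin assms by auto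
  have "card (B - A) = card (B' - A')"
    using fin assms by (simp add: card_Diff_subset_Int Int_commute)
  moreover have "card (U - A) = card (U - A')"
    using fin assms by (simp add: card_Diff_subset)
  moreover have "finite (U - A)" "finite (U - A')" "B - A \<subseteq> U - A" "B' - A' \<subseteq> U - A'"
    using assms by auto
  ultimately obtain g where g: "bij_betw g (U - A) (U - A')" "g ` (B - A) = B' - A'"
    using bij_betw_subset_onto[of "U - A" "U - A'" "B - A" "B' - A'"] by metis
  define \<sigma> where "\<sigma> = (\<lambda>x. if x \<in> A then f x else if x \<in> U then g x else x)"
  have "bij_betw (\<lambda>x. if x \<in> A then f x else g x) (A \<union> (U - A)) (A' \<union> (U - A'))"
    by (rule bij_betw_disjoint_Un[OF f(1) g(1)]) auto
  moreover have "A \<union> (U - A) = U" "A' \<union> (U - A') = U" using assms by auto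
  ultimately have "bij_betw (\<lambda>x. if x \<in> A then f x else g x) U U" by metis
  then have "bij_betw \<sigma> U U" by (rule bij_betw_cong[THEN iffD1, rotated]) (auto simp: \<sigma>_def)
  then have "\<sigma> permutes U"
    by (rule bij_imp_permutes) (use assms(2) in \<open>auto simp: \<sigma>_def\<close>)
  moreover have "\<sigma> ` A = A'"
    using f(1) by (auto simp: \<sigma>_def bij_betw_def)
  moreover have "\<sigma> ` B = B'"
  proof -
    have "\<sigma> ` (A \<inter> B) = f ` (A \<inter> B)" "\<sigma> ` (B - A) = g ` (B - A)"
      using assms(3) by (auto simp: \<sigma>_def intro!: image_cong)
    moreover have "B = (A \<inter> B) \<union> (B - A)" by auto
    ultimately have "\<sigma> ` B = (A' \<inter> B') \<union> (B' - A')"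
      using f(2) g(2) by (metis image_Un)
    then show ?thesis by auto
  qed
  ultimately show ?thesis using that by blast
qed

text \<open>Up to scaling, this is the projection onto an eigenspace of the Johnson scheme.\<close>

definition symmetrized_pair_prod :: "nat \<Rightarrow> (nat \<times> nat) list \<Rightarrow> nat set \<Rightarrow> nat set \<Rightarrow> real" where
  "symmetrized_pair_prod n ps A B = (\<Sum>\<sigma> | \<sigma> permutes {1..n}. pair_prod ps (\<sigma> ` A) * pair_prod ps (\<sigma> ` B))"

lemma symmetrized_pair_prod_commute: "symmetrized_pair_prod n ps A B = symmetrized_pair_prod n ps B A"
  by (simp add: symmetrized_pair_prod_def mult.commute)

lemma psd_on_symmetrized_pair_prod: "psd_on V (symmetrized_pair_prod n ps)"
  unfolding psd_on_def
proof (intro conjI ballI allI symmetrized_pair_prod_commute)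
  fix x :: "nat set \<Rightarrow> real"
  have "(\<Sum>A\<in>V. \<Sum>B\<in>V. x A * symmetrized_pair_prod n ps A B * x B)
      = (\<Sum>A\<in>V. \<Sum>B\<in>V. \<Sum>\<sigma> | \<sigma> permutes {1..n}. (x A * pair_prod ps (\<sigma> ` A)) * (x B * pair_prod ps (\<sigma> ` B)))"
    by (simp add: symmetrized_pair_prod_def sum_distrib_left sum_distrib_right mult_ac)
  also have "\<dots> = (\<Sum>A\<in>V. \<Sum>\<sigma> | \<sigma> permutes {1..n}. \<Sum>B\<in>V. (x A * pair_prod ps (\<sigma> ` A)) * (x B * pair_prod ps (\<sigma> ` B)))"
    by (intro sum.cong refl sum.swap)
  also have "\<dots> = (\<Sum>\<sigma> | \<sigma> permutes {1..n}. \<Sum>A\<in>V. \<Sum>B\<in>V. (x A * pair_prod ps (\<sigma> ` A)) * (x B * pair_prod ps (\<sigma> ` B)))"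
    by (rule sum.swap)
  also have "\<dots> = (\<Sum>\<sigma> | \<sigma> permutes {1..n}. (\<Sum>A\<in>V. x A * pair_prod ps (\<sigma> ` A)) * (\<Sum>B\<in>V. x B * pair_prod ps (\<sigma> ` B)))"
    by (simp only: sum_product)
  also have "0 \<le> \<dots>" by (intro sum_nonneg) simp
  finally show "0 \<le> (\<Sum>A\<in>V. \<Sum>B\<in>V. x A * symmetrized_pair_prod n ps A B * x B)" .
qed

lemma symmetrized_pair_prod_permutes:
  assumes "\<tau> permutes {1..n}"
  shows "symmetrized_pair_prod n ps (\<tau> ` A) (\<tau> ` B) = symmetrized_pair_prod n ps A B"
  unfolding symmetrized_pair_prod_def
  by (subst (2) sum_permutations_compose_right[OF assms]) (simp add: image_comp)

text \<open>Permutations act transitively on pairs at a given distance. This provides the constants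
  \<open>p0\<close> and \<open>p1\<close> of the certificate.\<close>

lemma symmetrized_pair_prod_eq:
  assumes "A \<in> johnson_vertices n k" "B \<in> johnson_vertices n k"
    "A' \<in> johnson_vertices n k" "B' \<in> johnson_vertices n k" "card (A - B) = card (A' - B')"
  shows "symmetrized_pair_prod n ps A B = symmetrized_pair_prod n ps A' B'"
proof -
  note D = johnson_verticesD[OF assms(1)] johnson_verticesD[OF assms(2)]
    johnson_verticesD[OF assms(3)] johnson_verticesD[OF assms(4)]
  have "card (A \<inter> B) + card (A - B) = k" "card (A' \<inter> B') + card (A' - B') = k"
    using D card_Int_Diff by metis+
  then have "card (A \<inter> B) = card (A' \<inter> B')" using assms(5) by linarith
  then obtain \<tau> where "\<tau> permutes {1..n}" "\<tau> ` A = A'" "\<tau> ` B = B'"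
    using permutes_onto_pair[of "{1..n}" A B A' B'] D by auto
  then show ?thesis using symmetrized_pair_prod_permutes by metis
qed

text \<open>All diagonal entries agree, and at \<open>A0\<close> the identity contributes a positive
  term to a sum of squares.\<close>

lemma symmetrized_pair_prod_pos:
  assumes "A \<in> johnson_vertices n k" "A0 \<in> johnson_vertices n k" "pair_prod ps A0 \<noteq> 0"
  shows "0 < symmetrized_pair_prod n ps A A"
proof -
  have eq: "symmetrized_pair_prod n ps A A = symmetrized_pair_prod n ps A0 A0"
    by (rule symmetrized_pair_prod_eq) (use assms in auto)
  have "0 < pair_prod ps A0 * pair_prod ps A0"
    using assms(3) by (auto simp: zero_less_mult_iff linorder_neq_iff)
  also have "\<dots> \<le> symmetrized_pair_prod n ps A0 A0"
    using member_le_sum[of id "{\<sigma>. \<sigma> permutes {1..n}}" "\<lambda>\<sigma>. pair_prod ps (\<sigma> ` A0) * pair_prod ps (\<sigma> ` A0)"]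
    by (simp add: symmetrized_pair_prod_def permutes_id finite_permutations)
  finally show ?thesis by (simp only: eq)
qed

text \<open>Permutations preserve distances, so every relabelled product is an eigenvector with the
  same eigenvalue.\<close>

lemma symmetrized_pair_prod_eigen:
  assumes ps: "disjoint_pairs ps" "pair_support ps \<subseteq> {1..n}" and A: "A \<in> johnson_vertices n k"
  shows "(\<Sum>B\<in>johnson_vertices n k. of_bool (card (A - B) = i) * symmetrized_pair_prod n ps B C)
    = eberlein n k i (length ps) * symmetrized_pair_prod n ps A C"
proof -
  let ?V = "johnson_vertices n k"
  let ?S = "{\<sigma>. \<sigma> permutes {1..n}}"
  have *: "(\<Sum>B\<in>?V. of_bool (card (A - B) = i) * pair_prod ps (\<sigma> ` B)) = eberlein n k i (length ps) * pair_prod ps (\<sigma> ` A)"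
    if \<sigma>: "\<sigma> permutes {1..n}" for \<sigma>
  proof -
    have "(\<Sum>B\<in>?V. of_bool (card (A - B) = i) * pair_prod ps (\<sigma> ` B))
        = (\<Sum>B\<in>?V. of_bool (card (\<sigma> ` A - \<sigma> ` B) = i) * pair_prod ps (\<sigma> ` B))"
      by (simp add: card_permutes_image_diff[OF \<sigma>])
    also have "\<dots> = (\<Sum>B\<in>?V. of_bool (card (\<sigma> ` A - B) = i) * pair_prod ps B)"
      by (rule sum_johnson_vertices_permutes[OF \<sigma>])
    also have "\<dots> = eberlein n k i (length ps) * pair_prod ps (\<sigma> ` A)"
      by (intro johnson_eigenvectorD johnson_eigenvector_pair_prod ps permutes_image_johnson_vertices \<sigma> A)
    finally show ?thesis .
  qed
  have "(\<Sum>B\<in>?V. of_bool (card (A - B) = i) * symmetrized_pair_prod n ps B C)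
      = (\<Sum>B\<in>?V. \<Sum>\<sigma>\<in>?S. (of_bool (card (A - B) = i) * pair_prod ps (\<sigma> ` B)) * pair_prod ps (\<sigma> ` C))"
    by (simp only: symmetrized_pair_prod_def sum_distrib_left mult.assoc)
  also have "\<dots> = (\<Sum>\<sigma>\<in>?S. \<Sum>B\<in>?V. (of_bool (card (A - B) = i) * pair_prod ps (\<sigma> ` B)) * pair_prod ps (\<sigma> ` C))"
    by (rule sum.swap)
  also have "\<dots> = (\<Sum>\<sigma>\<in>?S. eberlein n k i (length ps) * pair_prod ps (\<sigma> ` A) * pair_prod ps (\<sigma> ` C))"
    by (intro sum.cong refl) (simp only: * mem_Collect_eq flip: sum_distrib_right)
  also have "\<dots> = eberlein n k i (length ps) * symmetrized_pair_prod n ps A C"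
    by (simp only: symmetrized_pair_prod_def sum_distrib_left mult.assoc)
  finally show ?thesis .
qed

lemma exists_separated_pairs:
  assumes "j \<le> k" "2 * k \<le> n"
  obtains ps where "disjoint_pairs ps" "pair_support ps \<subseteq> {1..n}" "length ps = j" "pair_prod ps {1..k} = 1"
proof -
  \<comment> \<open>For \<open>r < j\<close> the first element of the pair lies in
    \<open>{1..k}\<close> and the second in \<open>{k + 1..2 * k}\<close>, so every factor at
    \<open>{1..k}\<close> is 1.\<close>
  define ps where "ps = map (\<lambda>r. (Suc r, Suc (k + r)))"
  have supp: "x \<in> pair_support (ps xs) \<longleftrightarrow> (\<exists>r\<in>set xs. x = Suc r \<or> x = Suc (k + r))" for x xs
    by (auto simp: pair_support_iff ps_def)
  have "disjoint_pairs (ps xs) \<and> pair_prod (ps xs) {1..k} = 1" if "distinct xs" "set xs \<subseteq> {..<j}" for xs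
    using that
  proof (induction xs)
    case (Cons r xs)
    have "Suc r \<notin> pair_support (ps xs)" "Suc (k + r) \<notin> pair_support (ps xs)"
      using Cons.prems assms by (auto simp: supp)
    then show ?case using Cons assms by (simp add: ps_def)
  qed (simp add: ps_def)
  from this[of "[0..<j]"] have "disjoint_pairs (ps [0..<j])" "pair_prod (ps [0..<j]) {1..k} = 1"
    by (simp_all add: atLeast0LessThan)
  moreover have "pair_support (ps [0..<j]) \<subseteq> {1..n}"
    using assms by (auto simp: supp)
  moreover have "length (ps [0..<j]) = j" by (simp add: ps_def)
  ultimately show ?thesis using that by blast
qed

text \<open>Meeting in \<open>l\<close> points is being at distance \<open>k - l\<close>; the
  certificates are instantiated with that relation and with pairs whose number \<open>j\<close>
  belongs to the least eigenvalue.\<close>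

lemma theta_johnson_of_least_eigenvalue:
  assumes l: "l < k" and n: "2 * k \<le> n" and j: "j \<le> k"
    and neg: "eberlein n k (k - l) j < 0"
    and least: "\<And>j'. j' \<le> k \<Longrightarrow> eberlein n k (k - l) j \<le> eberlein n k (k - l) j'"
  defines "t \<equiv> 1 + real ((k choose (k - l)) * ((n - k) choose (k - l))) / (- eberlein n k (k - l) j)"
  shows "theta_johnson n k {l} = t"
    and "theta_johnson n k ({0..k - 1} - {l}) = real (n choose k) / t"
proof -
  let ?V = "johnson_vertices n k"
  define r where "r = (\<lambda>A B :: nat set. card (A - B) = k - l)"
  obtain ps where ps: "disjoint_pairs ps" "pair_support ps \<subseteq> {1..n}" "length ps = j" "pair_prod ps {1..k} = 1"
    using exists_separated_pairs[OF j n] .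
  have A0: "{1..k} \<in> ?V" using n by (simp add: johnson_vertices_def)
  \<comment> \<open>A reference neighbour of \<open>{1..k}\<close>: \<open>l\<close> common points
    and \<open>k - l\<close> fresh ones, available since \<open>2 * k \<le> n\<close>.\<close>
  obtain B0 where B0: "B0 \<in> ?V" "card ({1..k} - B0) = k - l"
  proof
    have "card ({1..l} \<union> {k+1..k + (k - l)}) = l + (k - l)"
      by (subst card_Un_disjoint) (use l in auto)
    then show "{1..l} \<union> {k+1..k + (k - l)} \<in> ?V"
      using l n by (auto simp: johnson_vertices_def)
    have "{1..k} - ({1..l} \<union> {k+1..k + (k - l)}) = {l+1..k}"
      using l by auto
    then show "card ({1..k} - ({1..l} \<union> {k+1..k + (k - l)})) = k - l" by simp
  qed
  have inter: "r A B \<longleftrightarrow> card (A \<inter> B) = l" "A \<noteq> B \<Longrightarrow> card (A \<inter> B) \<le> k - 1"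
    if "A \<in> ?V" "B \<in> ?V" for A B
  proof -
    note D = johnson_verticesD[OF that(1)] johnson_verticesD[OF that(2)]
    have sum: "card (A \<inter> B) + card (A - B) = k" using D card_Int_Diff by metis
    then show "r A B \<longleftrightarrow> card (A \<inter> B) = l" using l by (auto simp: r_def)
    show "card (A \<inter> B) \<le> k - 1" if "A \<noteq> B"
    proof -
      have "\<not> A \<subseteq> B" using that D card_subset_eq by metis
      then have "card (A - B) \<noteq> 0" using D by auto
      then show ?thesis using sum by linarith
    qed
  qed
  have self: "A \<in> ?V \<Longrightarrow> \<not> r A A" for A using l by (simp add: r_def)
  note pair = lovasz_theta_regular_pair[where V = ?V and r = r and M = "\<lambda>A B. of_bool (r A B)"
      and d = "real ((k choose (k - l)) * ((n - k) choose (k - l)))" and \<mu> = "- eberlein n k (k - l) j"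
      and P = "symmetrized_pair_prod n ps" and ?p0.0 = "symmetrized_pair_prod n ps {1..k} {1..k}"
      and ?p1.0 = "symmetrized_pair_prod n ps {1..k} B0"
      and E = "johnson_adj {l}" and E' = "johnson_adj ({0..k - 1} - {l})", OF finite_johnson_vertices _ refl self]
  have ne: "?V \<noteq> {}" using A0 by auto
  \<comment> \<open>The constant function is the product over no pairs, so the row sum is the
    eigenvalue at \<open>j = 0\<close>.\<close>
  have row: "(\<Sum>B\<in>?V. of_bool (r A B)) = real ((k choose (k - l)) * ((n - k) choose (k - l)))"
    if "A \<in> ?V" for A
    using johnson_eigenvectorD[OF johnson_eigenvector_pair_prod[of "[]" n k] that, of "k - l"]
    by (simp add: r_def eberlein_0_right)
  have deg: "0 < real ((k choose (k - l)) * ((n - k) choose (k - l)))"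
    using l n by (simp add: zero_less_binomial)
  have mu: "0 < - eberlein n k (k - l) j" using neg by simp
  have p0: "0 < symmetrized_pair_prod n ps {1..k} {1..k}"
    using symmetrized_pair_prod_pos[OF A0 A0, of ps] ps(4) by simp
  have psdM: "psd_on ?V (\<lambda>A B. of_bool (r A B) + - eberlein n k (k - l) j * of_bool (A = B))"
    unfolding r_def using least by (intro psd_on_johnson_distance n) simp
  have P0: "symmetrized_pair_prod n ps A A = symmetrized_pair_prod n ps {1..k} {1..k}" if "A \<in> ?V" for A
    by (rule symmetrized_pair_prod_eq[OF that that A0 A0]) simp
  have P1: "symmetrized_pair_prod n ps A B = symmetrized_pair_prod n ps {1..k} B0"
    if "A \<in> ?V" "B \<in> ?V" "r A B" for A B
    by (rule symmetrized_pair_prod_eq[OF that(1,2) A0 B0(1)]) (use that(3) B0(2) in \<open>simp add: r_def\<close>)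
  have eig: "(\<Sum>B\<in>?V. of_bool (r A B) * symmetrized_pair_prod n ps B C)
      = - (- eberlein n k (k - l) j) * symmetrized_pair_prod n ps A C" if "A \<in> ?V" "C \<in> ?V" for A C
    using symmetrized_pair_prod_eigen[OF ps(1,2) that(1), of "k - l" C] ps(3) by (simp add: r_def)
  have E: "johnson_adj {l} A B \<longleftrightarrow> A \<noteq> B \<and> \<not> r A B" if "A \<in> ?V" "B \<in> ?V" for A B
    using inter(1)[OF that] by (auto simp: johnson_adj_def)
  \<comment> \<open>Distinct vertices meet in at most \<open>k - 1\<close> points, so the only size
    outside this set is \<open>l\<close>.\<close>
  have E': "johnson_adj ({0..k - 1} - {l}) A B \<longleftrightarrow> r A B" if "A \<in> ?V" "B \<in> ?V" for A B
    using inter(1,2)[OF that] self[OF that(1)] by (auto simp: johnson_adj_def)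
  note facts = ne row deg mu p0 psdM psd_on_symmetrized_pair_prod P0 P1 eig E E'
  show "theta_johnson n k {l} = t"
    unfolding theta_johnson_def t_def by (rule pair(1); (rule facts; assumption)?)
  show "theta_johnson n k ({0..k - 1} - {l}) = real (n choose k) / t"
    unfolding theta_johnson_def t_def card_johnson_vertices[of n k, symmetric] by (rule pair(2); (rule facts; assumption)?)
qed

subsection \<open>Asymptotics of the least eigenvalue\<close>

text \<open>Convergence with error of order \<open>1 / n\<close>; closure under sums, products and
  quotients carries limits and errors along together.\<close>

definition near :: "(nat \<Rightarrow> real) \<Rightarrow> real \<Rightarrow> bool" where
  "near h c \<longleftrightarrow> (\<lambda>n. h n - c) \<in> O(\<lambda>n. 1 / real n)"

lemma near_const: "near (\<lambda>_. c) c"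
  by (simp add: near_def)

lemma near_LIMSEQ: "near h c \<Longrightarrow> h \<longlonglongrightarrow> c"
proof -
  assume "near h c"
  then have "(\<lambda>n. h n - c) \<in> O(\<lambda>n. 1 / real n)" by (simp add: near_def)
  also have "(\<lambda>n. 1 / real n) \<in> o(\<lambda>_. 1)"
    by (rule smalloI_tendsto) (auto intro: lim_1_over_n)
  finally have "(\<lambda>n. h n - c) \<longlonglongrightarrow> 0"
    by (auto dest: smalloD_tendsto)
  then show ?thesis by (simp add: LIM_zero_iff)
qed

lemma near_bigo_1: "near h c \<Longrightarrow> h \<in> O(\<lambda>_. 1)"
  by (rule bigoI_tendsto[where c = c]) (auto dest: near_LIMSEQ)

lemma near_1_over_n: "near (\<lambda>n. 1 / real n) 0"
  by (simp add: near_def)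

lemma near_cong: "eventually (\<lambda>n. g n = h n) sequentially \<Longrightarrow> near h c \<Longrightarrow> near g c"
  unfolding near_def by (subst landau_o.big.in_cong[where g = "\<lambda>n. h n - c"]) (auto elim: eventually_mono)

lemma near_add: "near g a \<Longrightarrow> near h b \<Longrightarrow> near (\<lambda>n. g n + h n) (a + b)"
  unfolding near_def using sum_in_bigo(1)[of "\<lambda>n. g n - a" _ _ "\<lambda>n. h n - b"]
  by (simp add: algebra_simps)

lemma near_sum: "(\<And>t. t \<in> T \<Longrightarrow> near (g t) (a t)) \<Longrightarrow> near (\<lambda>n. \<Sum>t\<in>T. g t n) (\<Sum>t\<in>T. a t)"
  by (induction T rule: infinite_finite_induct) (auto intro: near_add near_const)

lemma near_mult:
  assumes "near g a" "near h b"
  shows "near (\<lambda>n. g n * h n) (a * b)"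
proof -
  have "(\<lambda>n. (g n - a) * h n) \<in> O(\<lambda>n. 1 / real n * 1)"
    using assms(1) near_bigo_1[OF assms(2)] unfolding near_def by (rule landau_o.big.mult)
  moreover have "(\<lambda>n. a * (h n - b)) \<in> O(\<lambda>n. 1 / real n)"
    using assms(2) unfolding near_def by (cases "a = 0") auto
  ultimately have "(\<lambda>n. (g n - a) * h n + a * (h n - b)) \<in> O(\<lambda>n. 1 / real n)"
    by (intro sum_in_bigo) simp_all
  then show ?thesis by (simp add: near_def algebra_simps)
qed

text \<open>The difference of the inverses is \<open>h n - b\<close> times a convergent, hence
  bounded, factor.\<close>

lemma near_inverse:
  assumes "near h b" "b \<noteq> 0"
  shows "near (\<lambda>n. inverse (h n)) (inverse b)"
proof -
  have lim: "(\<lambda>n. - inverse (h n) * inverse b) \<longlonglongrightarrow> - inverse b * inverse b"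
    using near_LIMSEQ[OF assms(1)] assms(2) by (intro tendsto_intros)
  then have "(\<lambda>n. - inverse (h n) * inverse b) \<in> O(\<lambda>_. 1)"
    by (intro bigoI_tendsto[where c = "- inverse b * inverse b"]) auto
  then have *: "(\<lambda>n. (h n - b) * (- inverse (h n) * inverse b)) \<in> O(\<lambda>n. 1 / real n * 1)"
    using assms(1) unfolding near_def by (intro landau_o.big.mult)
  have "eventually (\<lambda>n. h n \<noteq> 0) sequentially"
    using near_LIMSEQ[OF assms(1)] assms(2) by (rule tendsto_imp_eventually_ne)
  then have "eventually (\<lambda>n. inverse (h n) - inverse b = (h n - b) * (- inverse (h n) * inverse b)) sequentially"
    by eventually_elim (use assms(2) in \<open>simp add: field_simps\<close>)
  from landau_o.big.in_cong[OF this] * show ?thesis by (simp only: near_def mult_1_right)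
qed

lemma near_divide: "near g a \<Longrightarrow> near h b \<Longrightarrow> b \<noteq> 0 \<Longrightarrow> near (\<lambda>n. g n / h n) (a / b)"
  using near_mult[OF _ near_inverse] by (simp add: divide_inverse)

section \<open>Growth of binomials and Eberlein numbers\<close>

lemma near_binomial_same: "near (\<lambda>n. real ((n - c) choose d) / real n ^ d) (1 / fact d)"
proof (induction d)
  case 0
  then show ?case by (simp add: near_const)
next
  case (Suc d)
  \<comment> \<open>The new factor \<open>(n - c - d) / n\<close> in passing from \<open>d\<close>
    to \<open>Suc d\<close>.\<close>
  have "near (\<lambda>n. 1 + - real (c + d) * (1 / real n)) 1"
    using near_add[OF near_const[of 1] near_mult[OF near_const[of "- real (c + d)"] near_1_over_n]]
    by simp
  from near_mult[OF near_mult[OF Suc.IH this] near_const[of "1 / real (Suc d)"]]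
  have "near (\<lambda>n. real ((n - c) choose d) / real n ^ d * (1 + - real (c + d) * (1 / real n)) * (1 / real (Suc d)))
      (1 / fact (Suc d))"
    by (simp add: field_simps)
  moreover have "eventually (\<lambda>n. real ((n - c) choose Suc d) / real n ^ Suc d
      = real ((n - c) choose d) / real n ^ d * (1 + - real (c + d) * (1 / real n)) * (1 / real (Suc d))) sequentially"
    \<comment> \<open>Beyond this threshold the subtraction \<open>n - c - d\<close> is
      exact.\<close>
    using eventually_ge_at_top[of "Suc (c + d)"]
  proof eventually_elim
    case (elim n)
    have "Suc d * ((n - c) choose Suc d) = (n - c - d) * ((n - c) choose d)"
      using binomial_absorb_comp[of "n - c" d] binomial_absorption[of d "n - c - 1"] elim
      by (metis Suc_times_binomial_add add.commute le_add_diff_inverse2 Suc_leD add_leD2 binomial_absorption mult.commute Suc_diff_Suc)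
    then have "real (Suc d) * real ((n - c) choose Suc d) = real (n - c - d) * real ((n - c) choose d)"
      by (metis of_nat_mult)
    moreover have "real (n - c - d) = real n - real (c + d)"
      using elim by simp
    ultimately have "real ((n - c) choose Suc d) = (real n - real (c + d)) * real ((n - c) choose d) / real (Suc d)"
      by (simp add: field_simps)
    moreover have "1 + - real (c + d) * (1 / real n) = (real n - real (c + d)) / real n"
      using elim by (simp add: field_simps)
    ultimately show ?case
      by (simp only: power_Suc times_divide_times_eq divide_divide_eq_left mult_1_right mult_1_left ac_simps)
  qed
  ultimately show ?case by (rule near_cong[rotated])
qed

text \<open>In lower degree at least one factor \<open>1 / n\<close> is left over, which gives the
  limit 0.\<close>

lemma near_binomial:
  assumes "d \<le> e"
  shows "near (\<lambda>n. real ((n - c) choose d) / real n ^ e) (if d = e then 1 / fact e else 0)"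
proof (cases "d = e")
  case True
  then show ?thesis by (simp add: near_binomial_same)
next
  case False
  then obtain m where e: "e = d + Suc m"
    using assms by (metis add_Suc_right le_eq_less_or_eq less_imp_Suc_add)
  have "near (\<lambda>n. (1 / real n) ^ m) (0 ^ m)"
  proof (induction m)
    case (Suc m)
    then show ?case using near_mult[OF near_1_over_n] by simp
  qed (simp add: near_const)
  from near_mult[OF near_binomial_same near_mult[OF near_1_over_n this]]
  have "near (\<lambda>n. real ((n - c) choose d) / real n ^ d * (1 / real n * (1 / real n) ^ m)) 0"
    by simp
  then show ?thesis
    using False by (simp add: e power_add power_divide mult_ac)
qed

text \<open>Term \<open>t\<close> grows with degree at most \<open>i - t\<close>. Degrees above
  \<open>e\<close> are absent, either because \<open>e = i\<close> or because
  \<open>(k - j) choose (i - t)\<close> is zero, so only \<open>t = i - e\<close> survives in the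
  limit.\<close>

lemma near_eberlein:
  assumes "e \<le> i" "e = i \<or> k - j \<le> e"
  shows "near (\<lambda>n. eberlein n k i j / real n ^ e)
    ((-1) ^ (i - e) * real (j choose (i - e)) * real ((k - j) choose e) / fact e)"
proof -
  define a where "a = (\<lambda>t. (-1) ^ t * real (j choose t) * real ((k - j) choose (i - t)))"
  have "near (\<lambda>n. \<Sum>t\<le>i. a t * (real ((n - (k + j)) choose (i - t)) / real n ^ e))
      (\<Sum>t\<le>i. a t * (if i - t = e then 1 / fact e else 0))"
  proof (rule near_sum)
    fix t assume "t \<in> {..i}"
    show "near (\<lambda>n. a t * (real ((n - (k + j)) choose (i - t)) / real n ^ e))
        (a t * (if i - t = e then 1 / fact e else 0))"
    proof (cases "i - t \<le> e")
      case True
      then show ?thesis by (intro near_mult near_const near_binomial)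
    next
      case False
      then have "k - j < i - t" using assms by auto
      then have "a t = 0" by (simp add: a_def)
      then show ?thesis by (simp add: near_const)
    qed
  qed
  also have "(\<Sum>t\<le>i. a t * (if i - t = e then 1 / fact e else 0)) = (\<Sum>t\<le>i. if t = i - e then a t / fact e else 0)"
    using assms(1) by (intro sum.cong) auto
  also have "\<dots> = (-1) ^ (i - e) * real (j choose (i - e)) * real ((k - j) choose e) / fact e"
    using assms(1) by (simp add: a_def)
  finally show ?thesis
    by (simp add: eberlein_def exchange_sum_def a_def sum_divide_distrib algebra_simps)
qed

text \<open>At \<open>j = l + 1\<close> the term \<open>t = 0\<close> vanishes because
  \<open>k - l - 1\<close> elements have no subset of size \<open>k - l\<close>; the negative term
  \<open>t = 1\<close> dominates.\<close>

lemma eberlein_last: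
  assumes "l < k"
  shows "near (\<lambda>n. eberlein n k (k - l) (l + 1) / real n ^ (k - l - 1)) (- real (l + 1) / fact (k - l - 1))"
proof -
  have "k - l - (k - l - 1) = 1" using assms by simp
  then show ?thesis
    using near_eberlein[of "k - l - 1" "k - l" k "l + 1"] by simp
qed

lemma eventually_eberlein_neg:
  assumes "l < k"
  shows "eventually (\<lambda>n. eberlein n k (k - l) (l + 1) < 0) sequentially"
proof -
  have "- real (l + 1) / fact (k - l - 1) < (0::real)"
    by (intro divide_neg_pos) auto
  from order_tendstoD(2)[OF near_LIMSEQ[OF eberlein_last[OF assms]] this]
  show ?thesis
    using eventually_gt_at_top[of 0]
    by eventually_elim (auto simp: divide_less_0_iff)
qed

text \<open>For \<open>j \<le> l\<close> the eigenvalue grows like a positive multiple of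
  \<open>n ^ (k - l)\<close>. For \<open>j > l + 1\<close> it is of smaller order than
  \<open>n ^ (k - l - 1)\<close>, the order of the negative value at
  \<open>j = l + 1\<close>.\<close>

lemma eventually_eberlein_min:
  assumes "l < k" "j \<le> k"
  shows "eventually (\<lambda>n. eberlein n k (k - l) (l + 1) \<le> eberlein n k (k - l) j) sequentially"
proof -
  consider "j \<le> l" | "j = l + 1" | "l + 1 < j" by linarith
  then show ?thesis
  proof cases
    case 1
    have "near (\<lambda>n. eberlein n k (k - l) j / real n ^ (k - l)) (real ((k - j) choose (k - l)) / fact (k - l))"
      using near_eberlein[of "k - l" "k - l" k j] by simp
    moreover have "real ((k - j) choose (k - l)) / fact (k - l) > (0::real)"
      using 1 by (simp add: zero_less_binomial)
    ultimately have "eventually (\<lambda>n. eberlein n k (k - l) j / real n ^ (k - l) > 0) sequentially"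
      using order_tendstoD(1) near_LIMSEQ by blast
    then show ?thesis
      using eventually_eberlein_neg[OF assms(1)] eventually_gt_at_top[of 0]
      by eventually_elim (auto simp: zero_less_divide_iff)
  next
    case 2
    then show ?thesis by simp
  next
    case 3
    then have "(k - j) choose (k - l - 1) = 0" using assms by (intro binomial_eq_0) auto
    moreover have "k - j \<le> k - l - 1" using 3 by simp
    ultimately have "near (\<lambda>n. eberlein n k (k - l) j / real n ^ (k - l - 1)) 0"
      using near_eberlein[of "k - l - 1" "k - l" k j] 3 assms by (simp del: binomial_eq_0_iff)
    from tendsto_diff[OF near_LIMSEQ[OF this] near_LIMSEQ[OF eberlein_last[OF assms(1)]]]
    have "(\<lambda>n. (eberlein n k (k - l) j - eberlein n k (k - l) (l + 1)) / real n ^ (k - l - 1))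
        \<longlonglongrightarrow> 0 - - real (l + 1) / fact (k - l - 1)"
      by (simp only: diff_divide_distrib)
    moreover have "0 - - real (l + 1) / fact (k - l - 1) > (0::real)" by (simp add: divide_less_0_iff)
    ultimately have "eventually (\<lambda>n. (eberlein n k (k - l) j - eberlein n k (k - l) (l + 1)) / real n ^ (k - l - 1) > 0) sequentially"
      by (rule order_tendstoD(1))
    then show ?thesis
      using eventually_gt_at_top[of 0] by eventually_elim (auto simp: zero_less_divide_iff)
  qed
qed

section \<open>Exact values and asymptotics\<close>

theorem theorem4:
  fixes k l :: nat
  assumes "l < k"
  defines "f \<equiv> (\<lambda>n::nat. 1 + real ((k choose (k - l)) * ((n - k) choose (k - l))) /
      (\<Sum>j = 0..k - l. (-1) ^ (j + 1) * real (l + 1 choose j) *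
          real ((k - l - 1) choose (k - l - j)) * real ((n - k - l - 1) choose (k - l - j))))"
  shows "(\<forall>\<^sub>F n in at_top. theta_johnson n k {l} = f n)
    \<and> (\<lambda>n. f n - real (k choose (k - l)) / real ((k - l) * (l + 1)) * real n) \<in> O(\<lambda>_. 1)
    \<and> (\<forall>\<^sub>F n in at_top. theta_johnson n k ({0..k - 1} - {l}) = real (n choose k) / theta_johnson n k {l})
    \<and> (\<lambda>n. theta_johnson n k ({0..k - 1} - {l})
         - real ((l + 1) * (k - l)) / real (fact k * (k choose (k - l))) * real n ^ (k - 1))
       \<in> O(\<lambda>n. real n powr (real k - 2))"
proof -
  define i where "i = k - l"
  \<comment> \<open>\<open>e\<close> is the \<mu> of the certificates, \<open>d\<close> the degree,
    and \<open>c\<close> the leading coefficient of \<open>f\<close>.\<close>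
  define e where "e = (\<lambda>n. - eberlein n k i (l + 1))"
  define d where "d = (\<lambda>n. real ((k choose i) * ((n - k) choose i)))"
  define c where "c = real (k choose i) / real (i * (l + 1))"
  have i: "i > 0" "i \<le> k" using assms by (auto simp: i_def)
  have c: "c \<noteq> 0" using i by (simp add: c_def del: of_nat_mult)
  have f: "f n = 1 + d n / e n" for n
  proof -
    have "e n = (\<Sum>j = 0..i. (-1) ^ (j + 1) * real (l + 1 choose j) *
          real ((k - l - 1) choose (i - j)) * real ((n - k - l - 1) choose (i - j)))"
      by (simp add: e_def eberlein_def exchange_sum_def atLeast0AtMost sum_negf[symmetric])
    then show ?thesis by (simp add: f_def d_def i_def)
  qed
  \<comment> \<open>The finitely many \<open>j \<le> k\<close> share one threshold for
    \<open>n\<close>.\<close>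
  have "eventually (\<lambda>n. \<forall>j\<in>{..k}. eberlein n k i (l + 1) \<le> eberlein n k i j) sequentially"
    unfolding i_def by (intro eventually_ball_finite ballI eventually_eberlein_min assms) auto
  with eventually_eberlein_neg[OF assms(1)] eventually_ge_at_top[of "2 * k"]
  have "eventually (\<lambda>n. theta_johnson n k {l} = f n \<and>
      theta_johnson n k ({0..k - 1} - {l}) = real (n choose k) / f n) sequentially"
  proof eventually_elim
    case (elim n)
    then show ?case
      using theta_johnson_of_least_eigenvalue[of l k n "l + 1"] assms(1)
      by (simp add: f d_def e_def i_def)
  qed
  then have theta: "eventually (\<lambda>n. theta_johnson n k {l} = f n) sequentially"
    and theta': "eventually (\<lambda>n. theta_johnson n k ({0..k - 1} - {l}) = real (n choose k) / f n) sequentially"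
    by (simp_all add: eventually_conj_iff)
  have "near (\<lambda>n. real (k choose i) * (real ((n - k) choose i) / real n ^ i)) (real (k choose i) * (1 / fact i))"
    by (intro near_mult near_const near_binomial_same)
  then have d_near: "near (\<lambda>n. d n / real n ^ i) (real (k choose i) / fact i)"
    by (simp add: d_def)
  have "near (\<lambda>n. - 1 * (eberlein n k i (l + 1) / real n ^ (i - 1))) (- 1 * (- real (l + 1) / fact (i - 1)))"
    unfolding i_def by (intro near_mult near_const eberlein_last assms)
  then have e_near: "near (\<lambda>n. e n / real n ^ (i - 1)) (real (l + 1) / fact (i - 1))"
    by (simp add: e_def add.commute)
  \<comment> \<open>\<open>d\<close> has order \<open>n ^ i\<close> and \<open>e\<close> has order
    \<open>n ^ (i - 1)\<close>, so \<open>f\<close> grows linearly.\<close>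
  have "near (\<lambda>n. 1 / real n + (d n / real n ^ i) / (e n / real n ^ (i - 1)))
      (0 + (real (k choose i) / fact i) / (real (l + 1) / fact (i - 1)))"
    by (intro near_add near_1_over_n near_divide d_near e_near) simp
  also have "0 + (real (k choose i) / fact i) / (real (l + 1) / fact (i - 1)) = c"
    unfolding c_def fact_reduce[OF i(1)] of_nat_mult by (simp del: of_nat_add)
  finally have f_near: "near (\<lambda>n. f n / real n) c"
  proof (rule near_cong[rotated])
    show "eventually (\<lambda>n. f n / real n = 1 / real n + (d n / real n ^ i) / (e n / real n ^ (i - 1))) sequentially"
      using eventually_gt_at_top[of 0]
    proof eventually_elim
      case (elim n)
      then have "real n ^ i = real n * real n ^ (i - 1)" using i(1) by (cases i) auto
      then show ?case using elim by (simp add: f add_divide_distrib)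
    qed
  qed
  \<comment> \<open>Multiplying by \<open>n\<close> turns the relative error \<open>1 / n\<close>
    into a bounded one.\<close>
  have "(\<lambda>n. (f n / real n - c) * real n) \<in> O(\<lambda>n. 1 / real n * real n)"
    using f_near unfolding near_def by (intro landau_o.big.mult_right)
  also have "(\<lambda>n. 1 / real n * real n) \<in> O(\<lambda>_. 1)"
    by (rule bigoI[where c = 1]) auto
  finally have "(\<lambda>n. (f n / real n - c) * real n) \<in> O(\<lambda>_. 1)" .
  moreover have ev: "eventually (\<lambda>n. (f n / real n - c) * real n = f n - c * real n) sequentially"
    using eventually_gt_at_top[of 0] by eventually_elim (simp add: field_simps)
  ultimately have f_asymp: "(\<lambda>n. f n - c * real n) \<in> O(\<lambda>_. 1)"
    using landau_o.big.in_cong[OF ev] by blast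
  define c' where "c' = real ((l + 1) * (k - l)) / real (fact k * (k choose (k - l)))"
  \<comment> \<open>A binomial of order \<open>n ^ k\<close> over the linear \<open>f\<close>;
    \<open>n - 0\<close> is the case \<open>c = 0\<close> of
    \<open>near_binomial_same\<close>.\<close>
  have "near (\<lambda>n. (real ((n - 0) choose k) / real n ^ k) / (f n / real n)) ((1 / fact k) / c)"
    by (intro near_divide near_binomial_same f_near c)
  also have "(1 / fact k) / c = c'"
    using i by (simp add: c_def c'_def i_def field_simps)
  finally have "(\<lambda>n. ((real (n choose k) / real n ^ k) / (f n / real n) - c') * real n ^ (k - 1))
      \<in> O(\<lambda>n. 1 / real n * real n ^ (k - 1))"
    unfolding near_def by (intro landau_o.big.mult_right) simp
  \<comment> \<open>The real exponent matters for \<open>k = 1\<close>: it is -1 there, while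
    natural subtraction \<open>k - 2\<close> would give 0.\<close>
  also have "(\<lambda>n. 1 / real n * real n ^ (k - 1)) \<in> O(\<lambda>n. real n powr (real k - 2))"
  proof (rule bigoI[where c = 1])
    show "eventually (\<lambda>n. norm (1 / real n * real n ^ (k - 1)) \<le> 1 * norm (real n powr (real k - 2))) sequentially"
      using eventually_gt_at_top[of 0]
    proof eventually_elim
      case (elim n)
      have "real n powr (real k - 2) = real n powr (real (k - 1) - 1)"
        using assms(1) by (simp add: of_nat_diff)
      also have "\<dots> = real n ^ (k - 1) / real n"
        using elim by (simp add: powr_diff powr_realpow)
      finally show ?case by simp
    qed
  qed
  finally have "(\<lambda>n. ((real (n choose k) / real n ^ k) / (f n / real n) - c') * real n ^ (k - 1))
      \<in> O(\<lambda>n. real n powr (real k - 2))" .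
  moreover have ev': "eventually (\<lambda>n. ((real (n choose k) / real n ^ k) / (f n / real n) - c') * real n ^ (k - 1)
      = theta_johnson n k ({0..k - 1} - {l}) - c' * real n ^ (k - 1)) sequentially"
    using theta' eventually_gt_at_top[of 0]
  proof eventually_elim
    case (elim n)
    have "real n ^ k = real n * real n ^ (k - 1)" using assms(1) by (cases k) auto
    then have "(real (n choose k) / real n ^ k) / (f n / real n) * real n ^ (k - 1) = real (n choose k) / f n"
      using elim by (simp add: field_simps)
    then show ?case using elim by (simp add: left_diff_distrib)
  qed
  ultimately have theta'_asymp: "(\<lambda>n. theta_johnson n k ({0..k - 1} - {l}) - c' * real n ^ (k - 1))
      \<in> O(\<lambda>n. real n powr (real k - 2))"
    using landau_o.big.in_cong[OF ev'] by blast
  have "eventually (\<lambda>n. theta_johnson n k ({0..k - 1} - {l}) = real (n choose k) / theta_johnson n k {l}) sequentially"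
    using theta theta' by eventually_elim simp
  with theta f_asymp theta'_asymp show ?thesis
    by (simp add: c_def c'_def i_def)
qed

end
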